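(* Let $\alpha,\beta\in K$ with $\alpha\beta(\alpha-\beta)(\alpha+\beta)\neq 0$ and let $\mathfrak M$ be the variety of associative algebras defined by the identity $\alpha[x,y]x+\beta x[x,y]=0$. Let $f(x_1,\ldots,x_r)$ be a polynomial, homogeneous of degree $n$, whose linearization generates an irreducible $S_n$-submodule of $P_n(\mathfrak M)$. Then the consequences of higher degree of $f$ in $F(\mathfrak M)$ are as follows. (a) If $f=x^n$, they are equivalent to the identity $x_1x_2\cdots x_{n+1}$. (b) If $f=[x_1,x_2]$, they are equivalent to the identity $[x_1,x_2]x_3$. (c) $f=[x_1,x_2]x_1$ and $f=S_3(x_1,x_2,x_3)$ do not have (nonzero) consequences of higher degree.
   Context: $K$ is a field of characteristic $0$; algebras are associative $K$-algebras, not necessarily unital. $A=K\langle x_1,x_2,\ldots\rangle$ is the free non-unitary associative algebra (the letters $x,y,z,\ldots$ also denote distinct free generators). For a variety $\mathfrak M$, $T(\mathfrak M)\subset A$ is the T-ideal of its polynomial identities and $F(\mathfrak M)=A/T(\mathfrak M)$ is the relatively free algebra. $P_n$ is the space of multilinear polynomials of degree $n$ in $x_1,\ldots,x_n$, a left $S_n$-module via $\sigma:x_{i_1}\cdots x_{i_n}\mapsto x_{\sigma(i_1)}\cdots x_{\sigma(i_n)}$, and $P_n(\mathfrak M)=P_n/(P_n\cap T(\mathfrak M))$. The submodule of $P_n(\mathfrak M)$ generated by the linearization of a homogeneous polynomial $f$ of degree $n$ is the one generated by the image of the complete linearization of $f$. $[x,y]=xy-yx$ and $S_n(x_1,\ldots,x_n)=\sum_{\sigma\in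 S_n}(-1)^\sigma x_{\sigma(1)}\cdots x_{\sigma(n)}$. For $f$ homogeneous of degree $n$, its consequences of higher degree in $F(\mathfrak M)$ are the elements of the T-ideal of $F(\mathfrak M)$ generated by $f$ all of whose homogeneous components have degree $>n$. They are "equivalent to the identities $g_1,\ldots,g_s$" if the set of all of them coincides with the T-ideal of $F(\mathfrak M)$ generated by $g_1,\ldots,g_s$; $f$ "does not have consequences of higher degree" if this set is $\{0\}$. *)

theory Defs
  imports
    "HOL-Library.Poly_Mapping"
    "HOL-Combinatorics.Permutations"
    "HOL-Algebra.QuotRing"
    "HOL-Algebra.Algebraic_Closure_Type"
begin

section \<open>Associative, not necessarily unital, algebras\<close>

text \<open>
  Scalars form a field given as a type. An algebra is a record of type \<^typ>\<open>('k, 'b) module\<close>;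
  its field \<^const>\<open>one\<close> plays no role and is never constrained.
\<close>

locale assoc_algebra = module "ring_of_type_algebra :: 'k ring" B
  for B :: "('k::field, 'b) module" +
  assumes mult_closed:
      "\<lbrakk>x \<in> carrier B; y \<in> carrier B\<rbrakk> \<Longrightarrow> x \<otimes>\<^bsub>B\<^esub> y \<in> carrier B"
    and mult_assoc:
      "\<lbrakk>x \<in> carrier B; y \<in> carrier B; z \<in> carrier B\<rbrakk>
        \<Longrightarrow> (x \<otimes>\<^bsub>B\<^esub> y) \<otimes>\<^bsub>B\<^esub> z = x \<otimes>\<^bsub>B\<^esub> (y \<otimes>\<^bsub>B\<^esub> z)"
    and mult_l_distr:
      "\<lbrakk>x \<in> carrier B; y \<in> carrier B; z \<in> carrier B\<rbrakk>
        \<Longrightarrow> (x \<oplus>\<^bsub>B\<^esub> y) \<otimes>\<^bsub>B\<^esub> z = x \<otimes>\<^bsub>B\<^esub> z \<oplus>\<^bsub>B\<^esub> y \<otimes>\<^bsub>B\<^esub> z"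
    and mult_r_distr:
      "\<lbrakk>x \<in> carrier B; y \<in> carrier B; z \<in> carrier B\<rbrakk>
        \<Longrightarrow> z \<otimes>\<^bsub>B\<^esub> (x \<oplus>\<^bsub>B\<^esub> y) = z \<otimes>\<^bsub>B\<^esub> x \<oplus>\<^bsub>B\<^esub> z \<otimes>\<^bsub>B\<^esub> y"
    and mult_smult_l:
      "\<lbrakk>x \<in> carrier B; y \<in> carrier B\<rbrakk>
        \<Longrightarrow> (c \<odot>\<^bsub>B\<^esub> x) \<otimes>\<^bsub>B\<^esub> y = c \<odot>\<^bsub>B\<^esub> (x \<otimes>\<^bsub>B\<^esub> y)"
    and mult_smult_r:
      "\<lbrakk>x \<in> carrier B; y \<in> carrier B\<rbrakk>
        \<Longrightarrow> x \<otimes>\<^bsub>B\<^esub> (c \<odot>\<^bsub>B\<^esub> y) = c \<odot>\<^bsub>B\<^esub> (x \<otimes>\<^bsub>B\<^esub> y)"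

definition alg_hom :: "('k, 'b) module \<Rightarrow> ('k, 'c) module \<Rightarrow> ('b \<Rightarrow> 'c) set" where
  "alg_hom B C = {h. h \<in> carrier B \<rightarrow> carrier C \<and>
     (\<forall>x\<in>carrier B. \<forall>y\<in>carrier B.
        h (x \<oplus>\<^bsub>B\<^esub> y) = h x \<oplus>\<^bsub>C\<^esub> h y \<and> h (x \<otimes>\<^bsub>B\<^esub> y) = h x \<otimes>\<^bsub>C\<^esub> h y) \<and>
     (\<forall>c. \<forall>x\<in>carrier B. h (c \<odot>\<^bsub>B\<^esub> x) = c \<odot>\<^bsub>C\<^esub> h x)}"

definition alg_ideal :: "('k::field, 'b) module \<Rightarrow> 'b set \<Rightarrow> bool" where
  "alg_ideal B I \<longleftrightarrow> submodule I (ring_of_type_algebra :: 'k ring) B \<and>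
     (\<forall>a\<in>I. \<forall>x\<in>carrier B. x \<otimes>\<^bsub>B\<^esub> a \<in> I \<and> a \<otimes>\<^bsub>B\<^esub> x \<in> I)"

definition T_ideal :: "('k::field, 'b) module \<Rightarrow> 'b set \<Rightarrow> bool" where
  "T_ideal B I \<longleftrightarrow> alg_ideal B I \<and> (\<forall>h\<in>alg_hom B B. h ` I \<subseteq> I)"

definition T_ideal_gen :: "('k::field, 'b) module \<Rightarrow> 'b set \<Rightarrow> 'b set" where
  "T_ideal_gen B S = \<Inter> {I. T_ideal B I \<and> S \<subseteq> I}"

text \<open>
  The quotient by an ideal. When \<^term>\<open>I\<close> is only a submodule, the result is still used as a
  quotient module, the multiplication then being meaningless.
\<close>

definition quot_alg :: "('k, 'b) module \<Rightarrow> 'b set \<Rightarrow> ('k, 'b set) module" where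
  "quot_alg B I = \<lparr>carrier = a_rcosets\<^bsub>B\<^esub> I, monoid.mult = rcoset_mult B I, one = undefined,
     zero = I, add = set_add B, module.smult = (\<lambda>c C. \<Union>x\<in>C. I +>\<^bsub>B\<^esub> (c \<odot>\<^bsub>B\<^esub> x))\<rparr>"


section \<open>The free algebra without unit\<close>

datatype word = Word (letters: "nat list")

instantiation word :: monoid_add
begin

definition zero_word :: word where
  "zero_word = Word []"

definition plus_word :: "word \<Rightarrow> word \<Rightarrow> word" where
  "plus_word u v = Word (letters u @ letters v)"

instance
  by standard (simp_all add: zero_word_def plus_word_def)

end

text \<open>
  With words under concatenation as exponents, the convolution product of
  \<^typ>\<open>word \<Rightarrow>\<^sub>0 'k\<close> is that of the free unital algebra; the free algebra without unit is the
  set of elements whose constant term (the coefficient of the empty word) vanishes.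
  Generators are indexed from 0: the usual $x_1, x_2, \ldots$ are \<open>gen 0, gen 1, \<dots>\<close>,
  and $P_n$ consists of polynomials in the generators with index in \<open>{..<n}\<close>.
\<close>

type_synonym 'k ncpoly = "word \<Rightarrow>\<^sub>0 'k"

definition ncmono :: "nat list \<Rightarrow> 'k::field ncpoly" where
  "ncmono is = Poly_Mapping.single (Word is) 1"

definition gen :: "nat \<Rightarrow> 'k::field ncpoly" where
  "gen i = ncmono [i]"

definition scale :: "'k::field \<Rightarrow> 'k ncpoly \<Rightarrow> 'k ncpoly" where
  "scale c f = Poly_Mapping.single 0 c * f"

definition free_alg :: "('k::field, 'k ncpoly) module" where
  "free_alg = \<lparr>carrier = {f. Poly_Mapping.lookup f 0 = 0}, monoid.mult = (*), one = undefined,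
     zero = 0, add = (+), module.smult = scale\<rparr>"

definition commutator :: "'k::field ncpoly \<Rightarrow> 'k ncpoly \<Rightarrow> 'k ncpoly" where
  "commutator f g = f * g - g * f"

definition standard_poly :: "nat \<Rightarrow> 'k::field ncpoly" where
  "standard_poly n =
     (\<Sum>\<sigma> | \<sigma> permutes {..<n}. scale (of_int (sign \<sigma>)) (ncmono (map \<sigma> [0..<n])))"

definition homogeneous :: "nat \<Rightarrow> 'k::field ncpoly \<Rightarrow> bool" where
  "homogeneous n f \<longleftrightarrow> f \<in> carrier free_alg \<and> (\<forall>w\<in>Poly_Mapping.keys f. length (letters w) = n)"

definition linear_ext :: "(word \<Rightarrow> 'k ncpoly) \<Rightarrow> 'k::field ncpoly \<Rightarrow> 'k ncpoly" where
  "linear_ext F f = (\<Sum>w\<in>Poly_Mapping.keys f. scale (Poly_Mapping.lookup f w) (F w))"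


section \<open>Varieties, their identities and relatively free algebras\<close>

definition satisfies :: "('k::field, 'b) module \<Rightarrow> 'k ncpoly \<Rightarrow> bool" where
  "satisfies B f \<longleftrightarrow> (\<forall>h\<in>alg_hom free_alg B. h f = \<zero>\<^bsub>B\<^esub>)"

text \<open>
  A variety is a class of algebras whose elements live in some type \<open>'b\<close>. Instantiating \<open>'b\<close> by
  \<^typ>\<open>'k ncpoly set\<close>, the type of the quotients of the free algebra, loses no generality:
  see \<open>identities_variety_universal\<close> and \<open>identities_variety_eq\<close> below.
\<close>

definition variety :: "'k::field ncpoly set \<Rightarrow> ('k, 'b) module set" where
  "variety G = {B. assoc_algebra B \<and> (\<forall>g\<in>G. satisfies B g)}"

definition identities :: "('k::field, 'b) module set \<Rightarrow> 'k ncpoly set" where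
  "identities V = {f \<in> carrier free_alg. \<forall>B\<in>V. satisfies B f}"

definition rel_free :: "('k::field, 'b) module set \<Rightarrow> ('k, 'k ncpoly set) module" where
  "rel_free V = quot_alg free_alg (identities V)"

definition proj :: "('k::field, 'b) module set \<Rightarrow> 'k ncpoly \<Rightarrow> 'k ncpoly set" where
  "proj V f = identities V +>\<^bsub>free_alg\<^esub> f"

text \<open>
  The relatively free algebra is graded by the images of the homogeneous polynomials, so an element
  has all its components in degrees above \<open>n\<close> iff it is the image of a polynomial without
  monomials of length at most \<open>n\<close>.
\<close>

definition higher_consequences ::
    "('k::field, 'b) module set \<Rightarrow> nat \<Rightarrow> 'k ncpoly \<Rightarrow> 'k ncpoly set set" where
  "higher_consequences V n f = {u \<in> T_ideal_gen (rel_free V) {proj V f}.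
     \<exists>p\<in>carrier free_alg. u = proj V p \<and> (\<forall>w\<in>Poly_Mapping.keys p. n < length (letters w))}"

definition higher_consequences_equiv ::
    "('k::field, 'b) module set \<Rightarrow> nat \<Rightarrow> 'k ncpoly \<Rightarrow> 'k ncpoly set \<Rightarrow> bool" where
  "higher_consequences_equiv V n f G \<longleftrightarrow>
     higher_consequences V n f = T_ideal_gen (rel_free V) (proj V ` G)"

definition no_higher_consequences ::
    "('k::field, 'b) module set \<Rightarrow> nat \<Rightarrow> 'k ncpoly \<Rightarrow> bool" where
  "no_higher_consequences V n f \<longleftrightarrow> higher_consequences V n f = {\<zero>\<^bsub>rel_free V\<^esub>}"


section \<open>Multilinear polynomials as modules over the symmetric group\<close>

definition multilinear :: "nat \<Rightarrow> 'k::field ncpoly set" where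
  "multilinear n = {f \<in> carrier free_alg.
     \<forall>w\<in>Poly_Mapping.keys f. distinct (letters w) \<and> set (letters w) = {..<n}}"

definition perm_act :: "(nat \<Rightarrow> nat) \<Rightarrow> 'k::field ncpoly \<Rightarrow> 'k ncpoly" where
  "perm_act \<sigma> = linear_ext (\<lambda>w. ncmono (map \<sigma> (letters w)))"

definition rel_multilinear ::
    "('k::field, 'b) module set \<Rightarrow> nat \<Rightarrow> ('k, 'k ncpoly set) module" where
  "rel_multilinear V n =
     quot_alg (free_alg\<lparr>carrier := multilinear n\<rparr>) (multilinear n \<inter> identities V)"

text \<open>
  A permutation acts on a coset in \<^const>\<open>rel_multilinear\<close> elementwise, since the submodule
  factored out is stable under the symmetric group.
\<close>

definition Sn_submodule ::
    "('k::field, 'b) module set \<Rightarrow> nat \<Rightarrow> 'k ncpoly set set \<Rightarrow> bool" where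
  "Sn_submodule V n N \<longleftrightarrow> submodule N (ring_of_type_algebra :: 'k ring) (rel_multilinear V n) \<and>
     (\<forall>\<sigma>. \<sigma> permutes {..<n} \<longrightarrow> (\<forall>C\<in>N. perm_act \<sigma> ` C \<in> N))"

definition Sn_submodule_gen ::
    "('k::field, 'b) module set \<Rightarrow> nat \<Rightarrow> 'k ncpoly set set \<Rightarrow> 'k ncpoly set set" where
  "Sn_submodule_gen V n S = \<Inter> {N. Sn_submodule V n N \<and> S \<subseteq> N}"

definition irreducible_Sn_submodule ::
    "('k::field, 'b) module set \<Rightarrow> nat \<Rightarrow> 'k ncpoly set set \<Rightarrow> bool" where
  "irreducible_Sn_submodule V n N \<longleftrightarrow> Sn_submodule V n N \<and> N \<noteq> {\<zero>\<^bsub>rel_multilinear V n\<^esub>} \<and>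
     (\<forall>N'. Sn_submodule V n N' \<and> N' \<subseteq> N \<longrightarrow> N' = {\<zero>\<^bsub>rel_multilinear V n\<^esub>} \<or> N' = N)"

text \<open>
  Let $f$ be multihomogeneous of degree $d_i$ in the $i$-th generator, and split the first
  $n = d_1 + d_2 + \cdots$ generators into consecutive blocks of lengths $d_1, d_2, \ldots$.
  The complete linearization of $f$ is the multilinear component of the polynomial obtained by
  substituting for each generator the sum of the generators in its block. On a monomial \<open>w\<close>
  it is the sum of the multilinear words in which every letter comes from the block of the letter
  of \<open>w\<close> at the same place; generator \<open>j\<close> belongs to the block of \<open>sort (letters w) ! j\<close>.
\<close>

definition linearize_word :: "word \<Rightarrow> 'k::field ncpoly" where
  "linearize_word w = (\<Sum>v | distinct v \<and> set v = {..<length (letters w)} \<and>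
      map (\<lambda>j. sort (letters w) ! j) v = letters w. ncmono v)"

definition linearize :: "'k::field ncpoly \<Rightarrow> 'k ncpoly" where
  "linearize = linear_ext linearize_word"

definition multihom_component :: "nat multiset \<Rightarrow> 'k::field ncpoly \<Rightarrow> 'k ncpoly" where
  "multihom_component m f =
     (\<Sum>w | w \<in> Poly_Mapping.keys f \<and> mset (letters w) = m. Poly_Mapping.single w (Poly_Mapping.lookup f w))"

text \<open>
  A polynomial homogeneous of total degree \<open>n\<close> is linearized one multihomogeneous component at a
  time; for a multihomogeneous \<open>f\<close> the generating set below is \<open>linearize f\<close>, together with 0.
\<close>

definition linearization_module ::
    "('k::field, 'b) module set \<Rightarrow> nat \<Rightarrow> 'k ncpoly \<Rightarrow> 'k ncpoly set set" where
  "linearization_module V n f = Sn_submodule_gen V n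
     (range (\<lambda>m. (multilinear n \<inter> identities V) +>\<^bsub>free_alg\<^esub> linearize (multihom_component m f)))"


section \<open>The identities of a variety do not depend on the universe\<close>


lemma free_alg_simps [simp]:
  "carrier free_alg = {f. Poly_Mapping.lookup f 0 = 0}"
  "monoid.mult free_alg = (*)"
  "add free_alg = (+)"
  "zero free_alg = 0"
  "module.smult free_alg = scale"
  by (simp_all add: free_alg_def)

lemma lookup_scale [simp]: "Poly_Mapping.lookup (scale c f) w = c * Poly_Mapping.lookup f w"
  unfolding scale_def by (simp flip: mult_map_scale_conv_mult add: map.rep_eq when_def)

lemma letters_eq_Nil_iff: "letters w = [] \<longleftrightarrow> w = 0"
  by (cases w) (simp add: zero_word_def)

lemma lookup_mult_zero_word:
  assumes "Poly_Mapping.lookup f (0::word) = 0"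
  shows "Poly_Mapping.lookup (f * g :: 'k::field ncpoly) 0 = 0"
    and "Poly_Mapping.lookup (g * f :: 'k::field ncpoly) 0 = 0"
proof -
  have z: "u = 0 \<and> v = 0" if "u + v = 0" for u v :: word
    using that by (cases u; cases v) (simp add: zero_word_def plus_word_def)
  have f: "0 \<notin> Poly_Mapping.keys f"
    using assms by (simp add: in_keys_iff)
  have "0 \<notin> Poly_Mapping.keys (f * g)"
  proof
    assume "0 \<in> Poly_Mapping.keys (f * g)"
    then obtain a b where "0 = a + b" "a \<in> Poly_Mapping.keys f"
      using keys_mult[of f g] by blast
    with f z[of a b] show False by metis
  qed
  moreover have "0 \<notin> Poly_Mapping.keys (g * f)"
  proof
    assume "0 \<in> Poly_Mapping.keys (g * f)"
    then obtain a b where "0 = a + b" "b \<in> Poly_Mapping.keys f"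
      using keys_mult[of g f] by blast
    with f z[of a b] show False by metis
  qed
  ultimately show "Poly_Mapping.lookup (f * g) 0 = 0" "Poly_Mapping.lookup (g * f) 0 = 0"
    by (simp_all add: in_keys_iff)
qed

lemma ncpoly_eq_sum:
  "f = (\<Sum>w\<in>Poly_Mapping.keys f. Poly_Mapping.single w (Poly_Mapping.lookup f w))"
  by (rule poly_mapping_eqI) (simp add: lookup_sum lookup_single when_def in_keys_iff)

lemma ncpoly_induct [case_names zero single add]:
  fixes f :: "'k::field ncpoly"
  assumes "P 0" "\<And>w c. P (Poly_Mapping.single w c)" "\<And>f g. P f \<Longrightarrow> P g \<Longrightarrow> P (f + g)"
  shows "P f"
proof -
  have "P (\<Sum>w\<in>A. Poly_Mapping.single w (Poly_Mapping.lookup f w))" if "finite A" for A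
    using that by induction (auto intro: assms)
  from this[OF finite_keys[of f]] show ?thesis
    by (simp flip: ncpoly_eq_sum)
qed

lemma mult_scale [simp]:
  fixes f g :: "'k::field ncpoly"
  shows "f * scale c g = scale c (f * g)" "scale c f * g = scale c (f * g)"
proof -
  have "f * Poly_Mapping.single 0 c = Poly_Mapping.single 0 c * f"
    by (induction f rule: ncpoly_induct) (auto simp: mult_single algebra_simps)
  then show "f * scale c g = scale c (f * g)"
    unfolding scale_def by (metis mult.assoc)
  show "scale c f * g = scale c (f * g)"
    by (simp add: scale_def mult.assoc)
qed

lemma scale_add:
  "scale c (f + g) = scale c f + scale c g" "scale (c + d) f = scale c f + scale d f"
  "scale (c * d) f = scale c (scale d f)" "scale 1 f = f" "scale c 0 = 0"
  by (rule poly_mapping_eqI, simp add: lookup_add algebra_simps)+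

lemma ring_of_type_algebra_simps:
  "carrier ring_of_type_algebra = UNIV" "add ring_of_type_algebra = (+)"
  "monoid.mult ring_of_type_algebra = (*)" "one ring_of_type_algebra = 1"
  by (simp_all add: ring_of_type_algebra_def)

lemma assoc_algebra_free_alg: "assoc_algebra (free_alg :: ('k::field, 'k ncpoly) module)"
proof -
  have "abelian_group (free_alg :: ('k::field, 'k ncpoly) module)"
  proof (rule abelian_groupI)
    show "\<exists>y\<in>carrier free_alg. y \<oplus>\<^bsub>free_alg\<^esub> x = \<zero>\<^bsub>free_alg\<^esub>" if "x \<in> carrier free_alg" for x :: "'k ncpoly"
      using that by (intro bexI[of _ "- x"]) auto
  qed (auto simp: lookup_add algebra_simps)
  then have "module (ring_of_type_algebra :: 'k ring) (free_alg :: ('k, 'k ncpoly) module)"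
    by (intro moduleI cring_from_type_algebra)
      (auto simp: ring_of_type_algebra_simps scale_add)
  then show ?thesis
    by (intro assoc_algebra.intro assoc_algebra_axioms.intro)
      (auto simp: lookup_mult_zero_word algebra_simps)
qed


lemma linear_ext_superset:
  assumes "finite A" "Poly_Mapping.keys f \<subseteq> A"
  shows "linear_ext F f = (\<Sum>w\<in>A. scale (Poly_Mapping.lookup f w) (F w))"
  unfolding linear_ext_def using assms
  by (intro sum.mono_neutral_left) (auto simp: in_keys_iff scale_def)

lemma linear_ext_add: "linear_ext F (f + g) = linear_ext F f + linear_ext F g"
proof -
  let ?A = "Poly_Mapping.keys f \<union> Poly_Mapping.keys g"
  have "Poly_Mapping.keys (f + g) \<subseteq> ?A"
    by (rule Poly_Mapping.keys_add)
  then show ?thesis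
    by (simp add: linear_ext_superset[of ?A] lookup_add scale_add sum.distrib)
qed

lemma linear_ext_single: "linear_ext F (Poly_Mapping.single w c) = scale c (F w)"
  by (subst linear_ext_superset[of "{w}"]) auto

lemma linear_ext_zero: "linear_ext F 0 = 0"
  by (simp add: linear_ext_def)

lemma scale_single: "scale c (Poly_Mapping.single w d) = Poly_Mapping.single w (c * d)"
  by (simp add: scale_def mult_single)

lemma linear_ext_scale: "linear_ext F (scale c f) = scale c (linear_ext F f)"
proof (induction f rule: ncpoly_induct)
  case (add f g)
  then show ?case
    by (simp only: scale_add linear_ext_add)
qed (simp_all add: scale_add linear_ext_zero scale_single linear_ext_single)

text \<open>The endomorphism of the free algebra with prescribed values on the generators.\<close>

definition substitute :: "(nat \<Rightarrow> 'k::field ncpoly) \<Rightarrow> 'k ncpoly \<Rightarrow> 'k ncpoly" where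
  "substitute \<phi> = linear_ext (\<lambda>w. prod_list (map \<phi> (letters w)))"

lemma substitute_mult: "substitute \<phi> (f * g) = substitute \<phi> f * substitute \<phi> g"
proof (induction f rule: ncpoly_induct)
  case (single u c)
  show ?case
  proof (induction g rule: ncpoly_induct)
    case (single v d)
    show ?case
      by (simp add: substitute_def mult_single linear_ext_single plus_word_def mult.commute[of c] flip: scale_add(3))
  next
    case (add f g)
    then show ?case
      by (simp add: substitute_def linear_ext_add algebra_simps)
  qed (simp add: substitute_def linear_ext_zero)
next
  case (add f g)
  then show ?case
    by (simp add: substitute_def linear_ext_add algebra_simps)
qed (simp add: substitute_def linear_ext_zero)

lemma substitute_gen: "substitute \<phi> (gen i) = \<phi> i"
  by (simp add: substitute_def gen_def ncmono_def linear_ext_single scale_add)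

lemma substitute_hom:
  assumes "\<And>i. \<phi> i \<in> carrier free_alg"
  shows "substitute \<phi> \<in> alg_hom free_alg free_alg"
proof -
  have "Poly_Mapping.lookup (prod_list (map \<phi> (letters w))) 0 = 0" if w: "w \<noteq> 0" for w
  proof -
    obtain i "is" where "letters w = i # is"
      using w by (cases "letters w") (auto simp: letters_eq_Nil_iff)
    with assms show ?thesis
      by (simp add: lookup_mult_zero_word)
  qed
  then have "Poly_Mapping.lookup f w = 0 \<or>
      Poly_Mapping.lookup (prod_list (map \<phi> (letters w))) 0 = 0"
    if "Poly_Mapping.lookup f 0 = 0" for f w
    using that by (cases "w = 0") auto
  then have "Poly_Mapping.lookup (substitute \<phi> f) 0 = 0" if "Poly_Mapping.lookup f 0 = 0" for f
    using that unfolding substitute_def linear_ext_def lookup_sum lookup_scale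
    by (intro sum.neutral) auto
  then have "substitute \<phi> \<in> carrier free_alg \<rightarrow> carrier free_alg"
    by simp
  then show ?thesis
    unfolding alg_hom_def
    by (simp add: substitute_mult) (simp add: substitute_def linear_ext_add linear_ext_scale)
qed

lemma alg_homD:
  assumes "h \<in> alg_hom B C" "x \<in> carrier B"
  shows "h x \<in> carrier C"
    and "y \<in> carrier B \<Longrightarrow> h (x \<oplus>\<^bsub>B\<^esub> y) = h x \<oplus>\<^bsub>C\<^esub> h y"
    and "y \<in> carrier B \<Longrightarrow> h (x \<otimes>\<^bsub>B\<^esub> y) = h x \<otimes>\<^bsub>C\<^esub> h y"
    and "h (c \<odot>\<^bsub>B\<^esub> x) = c \<odot>\<^bsub>C\<^esub> h x"
  using assms by (auto simp: alg_hom_def)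

lemma alg_hom_comp:
  assumes "h \<in> alg_hom B C" "k \<in> alg_hom C D"
  shows "(\<lambda>x. k (h x)) \<in> alg_hom B D"
  using assms by (auto simp: alg_hom_def Pi_iff)

context assoc_algebra
begin

lemma smult_zero_left: "x \<in> carrier B \<Longrightarrow> 0 \<odot>\<^bsub>B\<^esub> x = \<zero>\<^bsub>B\<^esub>"
  using smult_l_null by (simp add: ring_of_type_algebra_def)

lemma smult_carrier: "x \<in> carrier B \<Longrightarrow> c \<odot>\<^bsub>B\<^esub> x \<in> carrier B"
  using smult_closed by (simp add: ring_of_type_algebra_def)

lemma smult_simps:
  "x \<in> carrier B \<Longrightarrow> (c + d) \<odot>\<^bsub>B\<^esub> x = c \<odot>\<^bsub>B\<^esub> x \<oplus>\<^bsub>B\<^esub> d \<odot>\<^bsub>B\<^esub> x"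
  "x \<in> carrier B \<Longrightarrow> y \<in> carrier B \<Longrightarrow> c \<odot>\<^bsub>B\<^esub> (x \<oplus>\<^bsub>B\<^esub> y) = c \<odot>\<^bsub>B\<^esub> x \<oplus>\<^bsub>B\<^esub> c \<odot>\<^bsub>B\<^esub> y"
  "x \<in> carrier B \<Longrightarrow> (c * d) \<odot>\<^bsub>B\<^esub> x = c \<odot>\<^bsub>B\<^esub> (d \<odot>\<^bsub>B\<^esub> x)"
  "x \<in> carrier B \<Longrightarrow> 1 \<odot>\<^bsub>B\<^esub> x = x"
  using smult_l_distr smult_r_distr smult_assoc1 smult_one by (simp_all add: ring_of_type_algebra_def)

lemma a_inv_smult: "x \<in> carrier B \<Longrightarrow> \<ominus>\<^bsub>B\<^esub> x = (- 1) \<odot>\<^bsub>B\<^esub> x"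
  using smult_simps(1)[of x "- 1" 1] smult_carrier[of x "- 1"]
  by (intro M.minus_equality) (simp_all add: smult_zero_left smult_simps)

lemma alg_ideal_iff:
  "alg_ideal B I \<longleftrightarrow> I \<subseteq> carrier B \<and> \<zero>\<^bsub>B\<^esub> \<in> I \<and> (\<forall>a\<in>I. \<forall>b\<in>I. a \<oplus>\<^bsub>B\<^esub> b \<in> I) \<and>
     (\<forall>c. \<forall>a\<in>I. c \<odot>\<^bsub>B\<^esub> a \<in> I) \<and> (\<forall>a\<in>I. \<forall>x\<in>carrier B. x \<otimes>\<^bsub>B\<^esub> a \<in> I \<and> a \<otimes>\<^bsub>B\<^esub> x \<in> I)"
  (is "?L \<longleftrightarrow> ?R")
proof
  assume ?L
  then have s: "submodule I ring_of_type_algebra B"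
    by (simp add: alg_ideal_def)
  note E = submoduleE[OF s]
  have "\<zero>\<^bsub>B\<^esub> \<in> I"
    using s subgroup.one_closed submodule.axioms(1) by fastforce
  with E \<open>?L\<close> show ?R
    by (auto simp: alg_ideal_def ring_of_type_algebra_def)
next
  assume R: ?R
  then have "submodule I ring_of_type_algebra B"
    by (intro submoduleI) (auto simp: a_inv_smult subset_iff)
  with R show ?L
    by (simp add: alg_ideal_def)
qed

lemma abelian_subgroup_alg_ideal: "alg_ideal B I \<Longrightarrow> abelian_subgroup I B"
  by (intro abelian_subgroupI3 additive_subgroup.intro M.abelian_group_axioms)
    (simp add: alg_ideal_def submodule_def)

lemma T_ideal_gen_T_ideal:
  assumes "S \<subseteq> carrier B"
  shows "T_ideal B (T_ideal_gen B S)" "S \<subseteq> T_ideal_gen B S"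
proof -
  have "T_ideal B (carrier B)"
    by (auto simp: T_ideal_def alg_ideal_iff smult_carrier mult_closed alg_hom_def)
  with assms have ne: "carrier B \<in> {I. T_ideal B I \<and> S \<subseteq> I}"
    by simp
  let ?F = "{I. T_ideal B I \<and> S \<subseteq> I}"
  have F: "alg_ideal B I" "\<And>h. h \<in> alg_hom B B \<Longrightarrow> h ` I \<subseteq> I" if "I \<in> ?F" for I
    using that by (auto simp: T_ideal_def)
  have "alg_ideal B (\<Inter> ?F)"
    unfolding alg_ideal_iff
  proof (intro conjI ballI allI InterI)
    show "\<Inter> ?F \<subseteq> carrier B"
      using ne by blast
  qed (use F(1) in \<open>unfold alg_ideal_iff, blast+\<close>)
  moreover have "h ` \<Inter> ?F \<subseteq> \<Inter> ?F" if "h \<in> alg_hom B B" for h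
    using F(2)[OF _ that] by blast
  ultimately show "T_ideal B (T_ideal_gen B S)"
    by (simp add: T_ideal_def T_ideal_gen_def)
  show "S \<subseteq> T_ideal_gen B S"
    by (auto simp: T_ideal_gen_def)
qed

end

locale alg_ideal_pair = assoc_algebra B for B :: "('k::field, 'b) module" +
  fixes I :: "'b set"
  assumes alg_ideal: "alg_ideal B I"
begin

sublocale sub: abelian_subgroup I B
  using alg_ideal by (rule abelian_subgroup_alg_ideal)

abbreviation cls where "cls x \<equiv> I +>\<^bsub>B\<^esub> x"

lemma cls_memE:
  assumes "a \<in> cls x" "x \<in> carrier B"
  obtains i where "i \<in> I" "i \<in> carrier B" "a = i \<oplus>\<^bsub>B\<^esub> x"
  using assms sub.a_subset by (auto simp: a_r_coset_def')

lemma cls_add_ideal: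
  assumes "i \<in> I" "x \<in> carrier B"
  shows "cls (i \<oplus>\<^bsub>B\<^esub> x) = cls x"
  using assms sub.a_subset by (metis M.a_rcosI sub.a_repr_independence')

lemma cls_mult: 
  assumes "x \<in> carrier B" "y \<in> carrier B"
  shows "rcoset_mult B I (cls x) (cls y) = cls (x \<otimes>\<^bsub>B\<^esub> y)"
proof -
  have "cls (a \<otimes>\<^bsub>B\<^esub> b) = cls (x \<otimes>\<^bsub>B\<^esub> y)" if a: "a \<in> cls x" and b: "b \<in> cls y" for a b
  proof -
    obtain i where i: "i \<in> I" "i \<in> carrier B" "a = i \<oplus>\<^bsub>B\<^esub> x"
      using cls_memE[OF a assms(1)] .
    obtain j where j: "j \<in> I" "j \<in> carrier B" "b = j \<oplus>\<^bsub>B\<^esub> y"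
      using cls_memE[OF b assms(2)] .
    have "a \<otimes>\<^bsub>B\<^esub> b = (i \<otimes>\<^bsub>B\<^esub> j \<oplus>\<^bsub>B\<^esub> i \<otimes>\<^bsub>B\<^esub> y \<oplus>\<^bsub>B\<^esub> x \<otimes>\<^bsub>B\<^esub> j) \<oplus>\<^bsub>B\<^esub> x \<otimes>\<^bsub>B\<^esub> y"
      using assms i j by (simp add: mult_l_distr mult_r_distr mult_closed M.a_ac)
    moreover have "i \<otimes>\<^bsub>B\<^esub> j \<oplus>\<^bsub>B\<^esub> i \<otimes>\<^bsub>B\<^esub> y \<oplus>\<^bsub>B\<^esub> x \<otimes>\<^bsub>B\<^esub> j \<in> I"
      using alg_ideal assms i j by (simp add: alg_ideal_iff)
    ultimately show ?thesis
      using assms by (simp add: cls_add_ideal mult_closed)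
  qed
  moreover have "x \<in> cls x" "y \<in> cls y"
    using assms sub.a_rcos_self by auto
  ultimately show ?thesis
    unfolding rcoset_mult_def by blast
qed

lemma cls_smult:
  assumes "x \<in> carrier B"
  shows "(\<Union>a\<in>cls x. cls (c \<odot>\<^bsub>B\<^esub> a)) = cls (c \<odot>\<^bsub>B\<^esub> x)"
proof -
  have "cls (c \<odot>\<^bsub>B\<^esub> a) = cls (c \<odot>\<^bsub>B\<^esub> x)" if a: "a \<in> cls x" for a
  proof -
    obtain i where i: "i \<in> I" "i \<in> carrier B" "a = i \<oplus>\<^bsub>B\<^esub> x"
      using cls_memE[OF a assms] .
    then have "c \<odot>\<^bsub>B\<^esub> i \<in> I"
      using alg_ideal by (simp add: alg_ideal_iff)
    with i assms show ?thesis
      by (simp add: smult_simps cls_add_ideal smult_carrier)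
  qed
  moreover have "x \<in> cls x"
    using assms sub.a_rcos_self by auto
  ultimately show ?thesis
    by blast
qed

lemma quot_alg_simps:
  "carrier (quot_alg B I) = cls ` carrier B"
  "\<zero>\<^bsub>quot_alg B I\<^esub> = cls \<zero>\<^bsub>B\<^esub>"
  "x \<in> carrier B \<Longrightarrow> y \<in> carrier B \<Longrightarrow> cls x \<oplus>\<^bsub>quot_alg B I\<^esub> cls y = cls (x \<oplus>\<^bsub>B\<^esub> y)"
  "x \<in> carrier B \<Longrightarrow> y \<in> carrier B \<Longrightarrow> cls x \<otimes>\<^bsub>quot_alg B I\<^esub> cls y = cls (x \<otimes>\<^bsub>B\<^esub> y)"
  "x \<in> carrier B \<Longrightarrow> c \<odot>\<^bsub>quot_alg B I\<^esub> cls x = cls (c \<odot>\<^bsub>B\<^esub> x)"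
proof -
  show "carrier (quot_alg B I) = cls ` carrier B"
    by (auto simp: quot_alg_def A_RCOSETS_def RCOSETS_def a_r_coset_def)
  show "\<zero>\<^bsub>quot_alg B I\<^esub> = cls \<zero>\<^bsub>B\<^esub>"
    using sub.a_subset by (simp add: quot_alg_def)
qed (simp_all add: quot_alg_def sub.a_rcos_sum cls_mult cls_smult)

lemma cls_eq_zero_iff: "x \<in> carrier B \<Longrightarrow> cls x = \<zero>\<^bsub>quot_alg B I\<^esub> \<longleftrightarrow> x \<in> I"
  using sub.a_subgroup M.a_coset_join1[of I x] M.a_coset_join2[of x I]
  unfolding quot_alg_def by auto

lemma assoc_algebra_quot_alg: "assoc_algebra (quot_alg B I)"
proof -
  note [simp] = quot_alg_simps smult_carrier mult_closed
  have "abelian_group (quot_alg B I)"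
  proof (rule abelian_groupI)
    show "\<exists>y\<in>carrier (quot_alg B I). y \<oplus>\<^bsub>quot_alg B I\<^esub> x = \<zero>\<^bsub>quot_alg B I\<^esub>"
      if x: "x \<in> carrier (quot_alg B I)" for x
    proof -
      obtain z where "z \<in> carrier B" "x = cls z"
        using x unfolding quot_alg_simps(1) by blast
      then show ?thesis
        by (intro bexI[of _ "cls (\<ominus>\<^bsub>B\<^esub> z)"]) (auto simp: M.l_neg)
    qed
  qed (auto simp: M.a_ac)
  then have "module (ring_of_type_algebra :: 'k ring) (quot_alg B I)"
    by (intro moduleI cring_from_type_algebra)
      (auto simp: ring_of_type_algebra_def smult_simps)
  then show ?thesis
    by (intro assoc_algebra.intro assoc_algebra_axioms.intro)
      (auto simp: mult_assoc mult_l_distr mult_r_distr mult_smult_l mult_smult_r)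
qed

lemma cls_hom: "cls \<in> alg_hom B (quot_alg B I)"
  by (auto simp: alg_hom_def quot_alg_simps)

end

lemma alg_hom_free_alg_eqI:
  fixes C :: "('k::field, 'b) module"
  assumes "assoc_algebra C" "h \<in> alg_hom free_alg C" "k \<in> alg_hom free_alg C"
    and gens: "\<And>i. h (gen i) = k (gen i)" and f: "f \<in> carrier free_alg"
  shows "h f = k f"
proof -
  interpret C: assoc_algebra C by fact
  have word: "Poly_Mapping.lookup (ncmono is :: 'k ncpoly) 0 = 0 \<and> h (ncmono is) = k (ncmono is)" if "is \<noteq> []" for "is"
    using that
  proof (induction "is" rule: list_nonempty_induct)
    case (single i)
    then show ?case
      using gens[of i] by (simp add: gen_def ncmono_def lookup_single zero_word_def)
  next
    case (cons i "is")
    have "ncmono (i # is) = gen i * (ncmono is :: 'k ncpoly)"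
      by (simp add: gen_def ncmono_def mult_single plus_word_def)
    moreover have "Poly_Mapping.lookup (ncmono (i # is) :: 'k ncpoly) 0 = 0"
      by (simp add: ncmono_def lookup_single zero_word_def)
    moreover have "Poly_Mapping.lookup (gen i :: 'k ncpoly) 0 = 0"
      by (simp add: gen_def ncmono_def lookup_single zero_word_def)
    ultimately show ?case
      using cons gens[of i] alg_homD(3)[OF assms(2), of "gen i" "ncmono is"]
        alg_homD(3)[OF assms(3), of "gen i" "ncmono is"]
      by (simp add: lookup_mult_zero_word)
  qed
  have mon: "Poly_Mapping.lookup (Poly_Mapping.single w c) 0 = 0 \<and>
      h (Poly_Mapping.single w c) = k (Poly_Mapping.single w c)" if "w \<noteq> 0" for w c
  proof -
    have ne: "letters w \<noteq> []"
      using that by (simp add: letters_eq_Nil_iff)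
    have "Poly_Mapping.single w c = scale c (ncmono (letters w))"
      by (simp add: ncmono_def scale_single)
    with word[OF ne] alg_homD(4)[OF assms(2), of "ncmono (letters w)" c]
      alg_homD(4)[OF assms(3), of "ncmono (letters w)" c]
    show ?thesis
      by simp
  qed
  have zero: "h 0 = k 0"
    using alg_homD(1)[OF assms(2), of 0] alg_homD(4)[OF assms(2), of 0 0]
      alg_homD(1)[OF assms(3), of 0] alg_homD(4)[OF assms(3), of 0 0]
    by (simp add: scale_add C.smult_zero_left)
  have "Poly_Mapping.lookup (\<Sum>w\<in>A. Poly_Mapping.single w (Poly_Mapping.lookup f w)) 0 = 0 \<and>
      h (\<Sum>w\<in>A. Poly_Mapping.single w (Poly_Mapping.lookup f w)) =
      k (\<Sum>w\<in>A. Poly_Mapping.single w (Poly_Mapping.lookup f w))" if "finite A" "0 \<notin> A" for A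
    using that
  proof induction
    case empty
    then show ?case by (simp add: zero)
  next
    case (insert w A)
    let ?s = "\<Sum>w\<in>A. Poly_Mapping.single w (Poly_Mapping.lookup f w)"
    let ?t = "Poly_Mapping.single w (Poly_Mapping.lookup f w)"
    have "w \<noteq> 0" and IH: "Poly_Mapping.lookup ?s 0 = 0 \<and> h ?s = k ?s"
      using insert by auto
    with mon[of w "Poly_Mapping.lookup f w"] have
      "h (?t + ?s) = k (?t + ?s)" "Poly_Mapping.lookup (?t + ?s) 0 = 0"
      using alg_homD(2)[OF assms(2), of ?t ?s] alg_homD(2)[OF assms(3), of ?t ?s]
      by (simp_all add: lookup_add)
    with insert.hyps show ?case
      by simp
  qed
  from this[OF finite_keys[of f]] f show ?thesis
    by (simp add: in_keys_iff flip: ncpoly_eq_sum)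
qed

lemma satisfied_T_ideal:
  assumes "assoc_algebra B"
  shows "T_ideal free_alg {f \<in> carrier free_alg. satisfies B f}"
proof -
  interpret B: assoc_algebra B by fact
  interpret F: assoc_algebra free_alg by (rule assoc_algebra_free_alg)
  have z: "h 0 = \<zero>\<^bsub>B\<^esub>" if "h \<in> alg_hom free_alg B" for h
    using alg_homD(1)[OF that, of 0] alg_homD(4)[OF that, of 0 0] by (simp add: scale_add B.smult_zero_left)
  have s0: "c \<odot>\<^bsub>B\<^esub> \<zero>\<^bsub>B\<^esub> = \<zero>\<^bsub>B\<^esub>" for c
    using B.smult_r_null by (simp add: ring_of_type_algebra_def)
  have m0: "x \<otimes>\<^bsub>B\<^esub> \<zero>\<^bsub>B\<^esub> = \<zero>\<^bsub>B\<^esub>" "\<zero>\<^bsub>B\<^esub> \<otimes>\<^bsub>B\<^esub> x = \<zero>\<^bsub>B\<^esub>" if "x \<in> carrier B" for x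
    using that B.mult_smult_r[of x "\<zero>\<^bsub>B\<^esub>" 0] B.mult_smult_l[of "\<zero>\<^bsub>B\<^esub>" x 0]
    by (simp_all add: B.smult_zero_left B.mult_closed)
  have "alg_ideal free_alg {f \<in> carrier free_alg. satisfies B f}"
    unfolding F.alg_ideal_iff
    by (auto simp: satisfies_def z s0 m0 lookup_add lookup_mult_zero_word
        alg_homD(1)[where B = free_alg and C = B] alg_homD(2)[where B = free_alg and C = B, simplified]
        alg_homD(3)[where B = free_alg and C = B, simplified]
        alg_homD(4)[where B = free_alg and C = B, simplified])
  moreover have "satisfies B (h f)" if "h \<in> alg_hom free_alg free_alg" "satisfies B f" for h f
    using that(2) alg_hom_comp[OF that(1)] unfolding satisfies_def by fast
  ultimately show ?thesis
    using alg_homD(1)[where B = free_alg and C = free_alg] by (auto simp: T_ideal_def image_subset_iff)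
qed

lemma T_ideal_gen_satisfied:
  assumes "assoc_algebra B" "\<forall>g\<in>G. satisfies B g" "G \<subseteq> carrier free_alg" "f \<in> T_ideal_gen free_alg G"
  shows "satisfies B f"
  using assms satisfied_T_ideal[OF assms(1)] unfolding T_ideal_gen_def by blast

lemma quot_alg_in_variety:
  assumes "G \<subseteq> carrier free_alg"
  shows "quot_alg free_alg (T_ideal_gen free_alg G) \<in> variety G"
proof -
  let ?I = "T_ideal_gen free_alg G"
  interpret F: assoc_algebra free_alg by (rule assoc_algebra_free_alg)
  have T: "T_ideal free_alg ?I" and GI: "G \<subseteq> ?I"
    using F.T_ideal_gen_T_ideal[OF assms] by auto
  interpret Q: alg_ideal_pair free_alg ?I
    using T by (intro alg_ideal_pair.intro alg_ideal_pair_axioms.intro F.assoc_algebra_axioms) (simp add: T_ideal_def)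
  have "h g = \<zero>\<^bsub>quot_alg free_alg ?I\<^esub>"
    if g: "g \<in> G" and h: "h \<in> alg_hom free_alg (quot_alg free_alg ?I)" for g h
  proof -
    have "\<exists>r. r \<in> carrier free_alg \<and> h (gen i) = Q.cls r" for i
      using alg_homD(1)[OF h, of "gen i"]
      by (auto simp: Q.quot_alg_simps gen_def ncmono_def lookup_single zero_word_def)
    then obtain \<phi> where \<phi>: "\<And>i. \<phi> i \<in> carrier free_alg" "\<And>i. h (gen i) = Q.cls (\<phi> i)"
      by metis
    have s: "substitute \<phi> \<in> alg_hom free_alg free_alg"
      using \<phi>(1) by (rule substitute_hom)
    have "h g = Q.cls (substitute \<phi> g)"
      by (rule alg_hom_free_alg_eqI[OF Q.assoc_algebra_quot_alg h alg_hom_comp[OF s Q.cls_hom]])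
        (use assms g in \<open>auto simp: substitute_gen \<phi>(2)\<close>)
    moreover have "substitute \<phi> g \<in> ?I"
      using T s g GI by (auto simp: T_ideal_def)
    ultimately show ?thesis
      using Q.cls_eq_zero_iff[of "substitute \<phi> g"] Q.sub.a_subset by auto
  qed
  then show ?thesis
    by (simp add: variety_def satisfies_def Q.assoc_algebra_quot_alg)
qed

theorem identities_variety_eq:
  fixes G :: "'k::field ncpoly set"
  assumes "G \<subseteq> carrier free_alg"
  shows "identities (variety G :: ('k, 'k ncpoly set) module set) = T_ideal_gen free_alg G"
proof
  let ?I = "T_ideal_gen free_alg G"
  interpret F: assoc_algebra "free_alg :: ('k, 'k ncpoly) module" by (rule assoc_algebra_free_alg)
  interpret Q: alg_ideal_pair free_alg ?I
    using F.T_ideal_gen_T_ideal(1)[OF assms]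
    by (intro alg_ideal_pair.intro alg_ideal_pair_axioms.intro F.assoc_algebra_axioms) (simp add: T_ideal_def)
  show "identities (variety G :: ('k, 'k ncpoly set) module set) \<subseteq> ?I"
  proof
    fix f assume f: "f \<in> identities (variety G :: ('k, 'k ncpoly set) module set)"
    then have "satisfies (quot_alg free_alg ?I) f"
      using quot_alg_in_variety[OF assms] by (auto simp: identities_def)
    then have "Q.cls f = \<zero>\<^bsub>quot_alg free_alg ?I\<^esub>"
      using Q.cls_hom by (auto simp: satisfies_def)
    with f show "f \<in> ?I"
      using Q.cls_eq_zero_iff[of f] by (auto simp: identities_def)
  qed
  show "?I \<subseteq> identities (variety G :: ('k, 'k ncpoly set) module set)"
  proof
    fix f assume f: "f \<in> ?I"
    then have "f \<in> carrier free_alg"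
      using Q.sub.a_subset by blast
    moreover have "satisfies B f" if "B \<in> variety G" for B :: "('k, 'k ncpoly set) module"
      using that by (intro T_ideal_gen_satisfied[OF _ _ assms f]) (simp_all add: variety_def)
    ultimately show "f \<in> identities (variety G :: ('k, 'k ncpoly set) module set)"
      by (simp add: identities_def)
  qed
qed

theorem identities_variety_universal:
  fixes G :: "'k::field ncpoly set" and B :: "('k, 'b) module"
  assumes "G \<subseteq> carrier free_alg" "B \<in> variety G"
    and "f \<in> identities (variety G :: ('k, 'k ncpoly set) module set)"
  shows "satisfies B f"
proof (rule T_ideal_gen_satisfied[OF _ _ assms(1)])
  show "assoc_algebra B" "\<forall>g\<in>G. satisfies B g"
    using assms(2) by (simp_all add: variety_def)
  show "f \<in> T_ideal_gen free_alg G"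
    using assms(3) by (simp only: identities_variety_eq[OF assms(1)])
qed

end

theory Submission
  imports Defs "HOL-Combinatorics.Multiset_Permutations"
begin

text \<open>
  Modulo the identity, every two monomials of degree at least 4 that differ by a permutation of
  their letters are equal. Hence an element of degree at least 4 is zero in the relatively
  free algebra as soon as it vanishes on commutative algebras. The polynomials in (c) vanish
  there, and so do all their consequences. In (b) the identity \<open>[x\<^sub>1,x\<^sub>2]x\<^sub>3\<close> makes monomials of degree 3
  commute too, so it implies every consequence of \<open>[x\<^sub>1,x\<^sub>2]\<close> of degree at least 3. In (a), for \<open>n \<ge> 3\<close>, the
  linearization of \<open>x\<^sup>n\<close> multiplied by \<open>x\<^sub>n\<^sub>+\<^sub>1\<close> equals \<open>n! x\<^sub>1\<cdots>x\<^sub>n\<^sub>+\<^sub>1\<close>; for \<open>n = 2\<close> the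
  anticommutativity of algebras with \<open>x\<^sup>2 = 0\<close> already gives \<open>2xyz = 0\<close>.
\<close>


section \<open>The free algebra and its T-ideals\<close>

lemma scale_diff: "scale c (f - g) = scale c f - scale c g" "scale (c - d) f = scale c f - scale d f"
  by (rule poly_mapping_eqI, simp add: lookup_minus algebra_simps)+

lemma scale_minus: "scale c (- f) = - scale c f" "scale (- c) f = - scale c f"
  by (rule poly_mapping_eqI, simp)+

lemma scale_cancel: "c \<noteq> 0 \<Longrightarrow> scale (1 / c) (scale c f) = f"
  by (simp add: scale_add(4) flip: scale_add(3))

lemma ncmono_append: "ncmono (xs @ ys) = ncmono xs * ncmono ys"
  by (simp add: ncmono_def mult_single plus_word_def)

lemma ncmono_Nil: "ncmono [] = 1"
  by (simp add: ncmono_def flip: zero_word_def)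

lemma lookup_ncmono: "Poly_Mapping.lookup (ncmono xs) w = (1 when letters w = xs)"
  by (cases w) (auto simp: ncmono_def lookup_single when_def)

lemma ncmono_carrier: "xs \<noteq> [] \<Longrightarrow> ncmono xs \<in> carrier free_alg"
  by (simp add: lookup_ncmono zero_word_def)

lemma gen_carrier: "gen i \<in> carrier free_alg"
  unfolding gen_def by (rule ncmono_carrier) simp

lemma carrier_closed:
  assumes "f \<in> carrier free_alg" "g \<in> carrier free_alg"
  shows "f * g \<in> carrier free_alg" "f + g \<in> carrier free_alg" "f - g \<in> carrier free_alg"
    "commutator f g \<in> carrier free_alg"
  using assms by (simp_all add: lookup_mult_zero_word lookup_add lookup_minus commutator_def)

lemma scale_carrier: "f \<in> carrier free_alg \<Longrightarrow> scale c f \<in> carrier free_alg"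
  by simp

lemma ncpoly_as_ncmonos:
  "f = (\<Sum>w\<in>Poly_Mapping.keys f. scale (Poly_Mapping.lookup f w) (ncmono (letters w)))"
  by (subst ncpoly_eq_sum) (simp add: ncmono_def scale_single)

lemma prod_list_map_gen: "prod_list (map gen xs) = ncmono xs"
  by (induction xs) (simp_all add: ncmono_Nil gen_def flip: ncmono_append)

lemma substitute_add: "substitute \<phi> (f + g) = substitute \<phi> f + substitute \<phi> g"
  by (simp add: substitute_def linear_ext_add)

lemma substitute_scale: "substitute \<phi> (scale c f) = scale c (substitute \<phi> f)"
  by (simp add: substitute_def linear_ext_scale)

lemma substitute_diff: "substitute \<phi> (f - g) = substitute \<phi> f - substitute \<phi> g"
  using substitute_add[of \<phi> "f - g" g] by (simp add: algebra_simps)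

lemma substitute_zero: "substitute \<phi> 0 = 0"
  by (simp add: substitute_def linear_ext_zero)

lemma substitute_sum: "substitute \<phi> (sum F A) = (\<Sum>a\<in>A. substitute \<phi> (F a))"
  by (induction A rule: infinite_finite_induct) (simp_all add: substitute_add substitute_zero)

lemma substitute_ncmono: "substitute \<phi> (ncmono xs) = prod_list (map \<phi> xs)"
  by (simp add: substitute_def ncmono_def linear_ext_single scale_add)

lemma substitute_commutator:
  "substitute \<phi> (commutator f g) = commutator (substitute \<phi> f) (substitute \<phi> g)"
  by (simp add: commutator_def substitute_diff substitute_mult)

text \<open>Both sides are homomorphisms that agree on the free generators. Hence invariance of a
  set under all endomorphisms can be tested on substitutions alone, which is how
  \<open>free_T_idealI\<close> is stated.\<close>

lemma alg_endomorphism_eq_substitute: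
  fixes h :: "'k::field ncpoly \<Rightarrow> 'k ncpoly"
  assumes "h \<in> alg_hom free_alg free_alg" "f \<in> carrier free_alg"
  shows "h f = substitute (\<lambda>i. h (gen i)) f"
proof (rule alg_hom_free_alg_eqI[OF assoc_algebra_free_alg assms(1) _ _ assms(2)])
  show "substitute (\<lambda>i. h (gen i)) \<in> alg_hom free_alg free_alg"
    using alg_homD(1)[OF assms(1) gen_carrier] by (rule substitute_hom)
qed (simp add: substitute_gen)

locale free_T_ideal =
  fixes J :: "'k::field_char_0 ncpoly set"
  assumes T_ideal: "T_ideal free_alg J"
begin

lemma
  shows subset_carrier: "J \<subseteq> carrier free_alg"
    and zero: "0 \<in> J"
    and add: "a \<in> J \<Longrightarrow> b \<in> J \<Longrightarrow> a + b \<in> J"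
    and scale: "a \<in> J \<Longrightarrow> scale c a \<in> J"
    and mult_left: "a \<in> J \<Longrightarrow> x \<in> carrier free_alg \<Longrightarrow> x * a \<in> J"
    and mult_right: "a \<in> J \<Longrightarrow> x \<in> carrier free_alg \<Longrightarrow> a * x \<in> J"
proof -
  interpret F: assoc_algebra free_alg by (rule assoc_algebra_free_alg)
  have "alg_ideal free_alg J"
    using T_ideal by (simp add: T_ideal_def)
  then show "J \<subseteq> carrier free_alg" "0 \<in> J" "a \<in> J \<Longrightarrow> b \<in> J \<Longrightarrow> a + b \<in> J"
    "a \<in> J \<Longrightarrow> scale c a \<in> J" "a \<in> J \<Longrightarrow> x \<in> carrier free_alg \<Longrightarrow> x * a \<in> J"
    "a \<in> J \<Longrightarrow> x \<in> carrier free_alg \<Longrightarrow> a * x \<in> J"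
    by (auto simp: F.alg_ideal_iff)
qed

lemma diff: "a \<in> J \<Longrightarrow> b \<in> J \<Longrightarrow> a - b \<in> J"
  using add[of a "scale (- 1) b"] scale[of b "- 1"] by (simp add: scale_minus scale_add(4))

lemma sum: "(\<And>a. a \<in> A \<Longrightarrow> F a \<in> J) \<Longrightarrow> sum F A \<in> J"
  by (induction A rule: infinite_finite_induct) (auto intro: add zero)

lemma scale_iff: "c \<noteq> 0 \<Longrightarrow> scale c a \<in> J \<longleftrightarrow> a \<in> J"
  using scale scale_cancel by metis

lemma substitute: "a \<in> J \<Longrightarrow> (\<And>i. \<phi> i \<in> carrier free_alg) \<Longrightarrow> substitute \<phi> a \<in> J"
  using T_ideal substitute_hom[of \<phi>] unfolding T_ideal_def by blast

end

lemma free_T_idealI: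
  fixes J :: "'k::field_char_0 ncpoly set"
  assumes "J \<subseteq> carrier free_alg" "0 \<in> J" "\<And>a b. a \<in> J \<Longrightarrow> b \<in> J \<Longrightarrow> a + b \<in> J"
    "\<And>a c. a \<in> J \<Longrightarrow> scale c a \<in> J"
    "\<And>a x. a \<in> J \<Longrightarrow> x \<in> carrier free_alg \<Longrightarrow> x * a \<in> J \<and> a * x \<in> J"
    "\<And>a \<phi>. a \<in> J \<Longrightarrow> (\<And>i. \<phi> i \<in> carrier free_alg) \<Longrightarrow> substitute \<phi> a \<in> J"
  shows "free_T_ideal J"
proof
  interpret F: assoc_algebra free_alg by (rule assoc_algebra_free_alg)
  have "alg_ideal free_alg J"
    using assms(1-5) by (simp add: F.alg_ideal_iff)
  moreover have "h a \<in> J" if "h \<in> alg_hom free_alg free_alg" "a \<in> J" for h a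
  proof -
    have "substitute (\<lambda>i. h (gen i)) a \<in> J"
      using alg_homD(1)[OF that(1) gen_carrier] by (rule assms(6)[OF that(2)])
    then show ?thesis
      using that assms(1) alg_endomorphism_eq_substitute[of h a] by auto
  qed
  ultimately show "T_ideal free_alg J"
    by (auto simp: T_ideal_def)
qed

lemma free_T_ideal_gen: "S \<subseteq> carrier free_alg \<Longrightarrow> free_T_ideal (T_ideal_gen free_alg S)"
  by (simp add: free_T_ideal.intro assoc_algebra.T_ideal_gen_T_ideal(1)[OF assoc_algebra_free_alg])

lemma T_ideal_gen_incl: "S \<subseteq> T_ideal_gen B S"
  by (auto simp: T_ideal_gen_def)

lemma T_ideal_gen_least: "T_ideal B I \<Longrightarrow> S \<subseteq> I \<Longrightarrow> T_ideal_gen B S \<subseteq> I"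
  by (auto simp: T_ideal_gen_def)


section \<open>Commutativity in degree four\<close>

definition basic_identity :: "'k::field \<Rightarrow> 'k \<Rightarrow> 'k ncpoly \<Rightarrow> 'k ncpoly \<Rightarrow> 'k ncpoly" where
  "basic_identity \<alpha> \<beta> x y = scale \<alpha> (commutator x y * x) + scale \<beta> (x * commutator x y)"

definition linearized_identity ::
    "'k::field \<Rightarrow> 'k \<Rightarrow> 'k ncpoly \<Rightarrow> 'k ncpoly \<Rightarrow> 'k ncpoly \<Rightarrow> 'k ncpoly" where
  "linearized_identity \<alpha> \<beta> x z y = scale \<alpha> (commutator x y * z + commutator z y * x)
     + scale \<beta> (x * commutator z y + z * commutator x y)"

text \<open>The identity is quadratic in its first argument, so polarization yields a trilinear form
  of it whose values lie in every T-ideal containing the identity. The first two arguments are the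
  symmetric ones.\<close>

lemma linearized_identity_eq:
  "linearized_identity \<alpha> \<beta> x z y =
     basic_identity \<alpha> \<beta> (x + z) y - basic_identity \<alpha> \<beta> x y - basic_identity \<alpha> \<beta> z y"
  by (simp add: linearized_identity_def basic_identity_def commutator_def algebra_simps scale_add scale_diff)

text \<open>
  The coefficients were found by linear algebra over the field of rational functions in
  \<open>\<beta>/\<alpha>\<close>, applied to the degree four multilinear consequences of the identity.
\<close>

lemma left_commutator_certificate:
  fixes a b c d :: "'k::field ncpoly"
  shows "scale (3 * \<beta> * (\<alpha>^2 - \<beta>^2)) (a * b * commutator c d) =
    scale (2 * \<alpha>^2 - 2 * \<alpha> * \<beta> - \<beta>^2)
      (linearized_identity \<alpha> \<beta> (b * a) c d - linearized_identity \<alpha> \<beta> b c d * a)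
    + scale (\<alpha> * \<beta> - 2 * \<beta>^2)
      (linearized_identity \<alpha> \<beta> (b * a) d c - linearized_identity \<alpha> \<beta> b d c * a)
    + scale (\<alpha>^2 - \<beta>^2)
      (linearized_identity \<alpha> \<beta> (b * c) a d + linearized_identity \<alpha> \<beta> (b * d) c a
       + linearized_identity \<alpha> \<beta> b d a * c - linearized_identity \<alpha> \<beta> b c a * d)
    + scale (2 * \<beta>^2 + \<alpha> * \<beta> - \<alpha>^2) (linearized_identity \<alpha> \<beta> a d (b * c))
    + scale (2 * \<alpha>^2 - \<alpha> * \<beta> - 3 * \<beta>^2) (linearized_identity \<alpha> \<beta> a d b * c)
    + scale (2 * \<alpha> * \<beta> - \<alpha>^2)
      (scale 2 (b * linearized_identity \<alpha> \<beta> a c d) + b * linearized_identity \<alpha> \<beta> c d a)"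
  unfolding linearized_identity_def commutator_def
  by (rule poly_mapping_eqI) (simp add: algebra_simps lookup_add lookup_minus power2_eq_square)

locale variety_T_ideal = free_T_ideal J for J :: "'k::field_char_0 ncpoly set" +
  fixes \<alpha> \<beta> :: 'k
  assumes nondegenerate: "\<alpha> * \<beta> * (\<alpha> - \<beta>) * (\<alpha> + \<beta>) \<noteq> 0"
    and identity_mem: "basic_identity \<alpha> \<beta> (gen 0) (gen 1) \<in> J"
begin

lemma linearized_identity_mem:
  assumes "x \<in> carrier free_alg" "y \<in> carrier free_alg" "z \<in> carrier free_alg"
  shows "linearized_identity \<alpha> \<beta> x z y \<in> J"
proof -
  have basic: "basic_identity \<alpha> \<beta> a y \<in> J" if "a \<in> carrier free_alg" for a
    using substitute[OF identity_mem, of "\<lambda>i. if i = 0 then a else y"] that assms(2)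
    by (simp add: basic_identity_def substitute_add substitute_scale substitute_mult
        substitute_commutator substitute_gen)
  then show ?thesis
    unfolding linearized_identity_eq by (intro diff basic carrier_closed assms)
qed

lemma mult_commutator_mem:
  assumes "a \<in> carrier free_alg" "b \<in> carrier free_alg" "c \<in> carrier free_alg" "d \<in> carrier free_alg"
  shows "a * b * commutator c d \<in> J"
proof -
  \<comment> \<open>Up to the factor \<open>\<alpha>\<close> this is the nondegeneracy product; the
    3 added next is invertible because the characteristic is 0.\<close>
  have "\<beta> * (\<alpha>^2 - \<beta>^2) \<noteq> 0"
    using nondegenerate by (simp add: power2_eq_square square_diff_square_factored)
  then have "3 * \<beta> * (\<alpha>^2 - \<beta>^2) \<noteq> 0"
    by simp
  moreover have "scale (3 * \<beta> * (\<alpha>^2 - \<beta>^2)) (a * b * commutator c d) \<in> J"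
    unfolding left_commutator_certificate
    by (intro add diff scale mult_left mult_right linearized_identity_mem carrier_closed assms)
  ultimately show ?thesis
    by (simp add: scale_iff)
qed

text \<open>
  Modulo \<open>J\<close> the product \<open>a[b,c]d\<close> is alternating in \<open>b, c, d\<close>, hence a third of
  \<open>aS\<^sub>3(b,c,d)\<close>, and \<open>S\<^sub>3(b,c,d)\<close> is also the cyclic sum of \<open>b[c,d]\<close>. The same works
  for \<open>[a,b]cd\<close>.
\<close>

lemma mult_commutator_mult_mem:
  assumes "a \<in> carrier free_alg" "b \<in> carrier free_alg" "c \<in> carrier free_alg" "d \<in> carrier free_alg"
  shows "a * commutator b c * d \<in> J"
proof -
  have skew: "a * (commutator x y * z + commutator z y * x) \<in> J"
    if "x \<in> carrier free_alg" "y \<in> carrier free_alg" "z \<in> carrier free_alg" for x y z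
  proof -
    \<comment> \<open>After multiplication by \<open>a\<close> the \<open>\<beta>\<close> part has
      two factors to the left of each commutator, so \<open>mult_commutator_mem\<close> removes it
      and the \<open>\<alpha>\<close> part alone must lie in \<open>J\<close>.\<close>
    have "scale \<alpha> (a * (commutator x y * z + commutator z y * x)) = a * linearized_identity \<alpha> \<beta> x z y
        - scale \<beta> (a * x * commutator z y + a * z * commutator x y)"
      by (simp add: linearized_identity_def distrib_left mult.assoc)
    also have "\<dots> \<in> J"
      using assms that
      by (intro diff add scale mult_left[OF linearized_identity_mem] mult_commutator_mem)
    finally show ?thesis
      using nondegenerate by (simp add: scale_iff)
  qed
  have "scale 3 (a * commutator b c * d) =
      a * b * commutator c d + a * c * commutator d b + a * d * commutator b c
      + a * (commutator b c * d + commutator d c * b) - a * (commutator c b * d + commutator d b * c)"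
    by (rule poly_mapping_eqI) (simp add: commutator_def lookup_add lookup_minus algebra_simps)
  also have "\<dots> \<in> J"
    by (intro add diff skew mult_commutator_mem assms)
  finally show ?thesis
    by (simp add: scale_iff)
qed

lemma commutator_mult_mem:
  assumes "a \<in> carrier free_alg" "b \<in> carrier free_alg" "c \<in> carrier free_alg" "d \<in> carrier free_alg"
  shows "commutator a b * c * d \<in> J"
proof -
  have skew: "(commutator x y * z + commutator z y * x) * d \<in> J"
    if "x \<in> carrier free_alg" "y \<in> carrier free_alg" "z \<in> carrier free_alg" for x y z
  proof -
    \<comment> \<open>Here the commutators of the \<open>\<beta>\<close> part have a factor on
      either side, which is the case settled by \<open>mult_commutator_mult_mem\<close>.\<close>
    have "scale \<alpha> ((commutator x y * z + commutator z y * x) * d) = linearized_identity \<alpha> \<beta> x z y * d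
        - scale \<beta> (x * commutator z y * d + z * commutator x y * d)"
      by (simp add: linearized_identity_def distrib_right mult.assoc)
    also have "\<dots> \<in> J"
      using assms that
      by (intro diff add scale mult_right[OF linearized_identity_mem] mult_commutator_mult_mem)
    finally show ?thesis
      using nondegenerate by (simp add: scale_iff)
  qed
  have "scale 3 (commutator a b * c * d) =
      a * commutator b c * d + b * commutator c a * d + c * commutator a b * d
      + (commutator a b * c + commutator c b * a) * d - (commutator b a * c + commutator c a * b) * d"
    by (rule poly_mapping_eqI) (simp add: commutator_def lookup_add lookup_minus algebra_simps)
  also have "\<dots> \<in> J"
    by (intro add diff skew mult_commutator_mult_mem assms)
  finally show ?thesis
    by (simp add: scale_iff)
qed

text \<open>When all products \<open>[x,y]z\<close> vanish, only the \<open>\<beta>\<close> part of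
  the linearized identity survives and makes \<open>x[y,z]\<close> alternating. Then
  \<open>3x[y,z]\<close> is congruent to the standard polynomial of degree 3, which is also the
  cyclic sum of \<open>[x,y]z\<close> and so vanishes.\<close>

lemma left_commutator_mem:
  assumes right: "\<And>x y z. \<lbrakk>x \<in> carrier free_alg; y \<in> carrier free_alg; z \<in> carrier free_alg\<rbrakk>
      \<Longrightarrow> commutator x y * z \<in> J"
    and xyz: "x \<in> carrier free_alg" "y \<in> carrier free_alg" "z \<in> carrier free_alg"
  shows "x * commutator y z \<in> J"
proof -
  have skew: "a * commutator c b + c * commutator a b \<in> J"
    if "a \<in> carrier free_alg" "b \<in> carrier free_alg" "c \<in> carrier free_alg" for a b c
  proof -
    have "scale \<beta> (a * commutator c b + c * commutator a b) =
        linearized_identity \<alpha> \<beta> a c b - scale \<alpha> (commutator a b * c + commutator c b * a)"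
      by (simp add: linearized_identity_def)
    also have "\<dots> \<in> J"
      by (intro diff add scale linearized_identity_mem right that)
    finally show ?thesis
      using nondegenerate by (simp add: scale_iff)
  qed
  have "scale 3 (x * commutator y z) =
      commutator x y * z + commutator y z * x + commutator z x * y
      + (x * commutator y z + y * commutator x z) - (x * commutator z y + z * commutator x y)"
    by (rule poly_mapping_eqI) (simp add: commutator_def lookup_add lookup_minus algebra_simps)
  also have "\<dots> \<in> J"
    by (intro add diff skew right xyz)
  finally show ?thesis
    by (simp add: scale_iff)
qed

end


section \<open>Polynomials vanishing on commutative algebras\<close>

text \<open>The strict bound matches the degree condition in \<open>higher_consequences\<close>; the
  bound 0 gives the free algebra without unit.\<close>

definition words_above :: "nat \<Rightarrow> 'k::field ncpoly set" where
  "words_above N = {p. \<forall>w\<in>Poly_Mapping.keys p. N < length (letters w)}"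

lemma words_above_carrier: "words_above N \<subseteq> carrier free_alg"
proof
  fix p :: "'k::field ncpoly" assume "p \<in> words_above N"
  then have "0 \<notin> Poly_Mapping.keys p"
    by (force simp: words_above_def zero_word_def)
  then show "p \<in> carrier free_alg"
    by (simp add: in_keys_iff)
qed

lemma ncmono_words_above: "N < length xs \<Longrightarrow> ncmono xs \<in> words_above N"
  by (simp add: words_above_def ncmono_def)

text \<open>Lengths of at least \<open>M + 1\<close> and \<open>N + 1\<close> add up to at least
  \<open>M + N + 2\<close>, hence the extra 1 in the bound.\<close>

lemma words_above_mult_le:
  assumes "p \<in> words_above M" "q \<in> words_above N"
  shows "p * q \<in> words_above (M + N + 1)"
proof -
  have "M + N + 1 < length (letters w)" if w: "w \<in> Poly_Mapping.keys (p * q)" for w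
  proof -
    obtain u v where "w = u + v" "u \<in> Poly_Mapping.keys p" "v \<in> Poly_Mapping.keys q"
      using w keys_mult[of p q] by blast
    with assms show ?thesis
      by (fastforce simp: words_above_def plus_word_def)
  qed
  then show ?thesis
    by (simp add: words_above_def)
qed

lemma words_above_antimono: "M \<le> N \<Longrightarrow> words_above N \<subseteq> words_above M"
  by (fastforce simp: words_above_def)

lemma carrier_eq_words_above: "carrier free_alg = words_above 0"
proof
  show "carrier free_alg \<subseteq> (words_above 0 :: 'k::field ncpoly set)"
    by (auto simp: words_above_def in_keys_iff letters_eq_Nil_iff)
qed (rule words_above_carrier)

text \<open>No factor has a constant term, so each contributes at least one letter to every
  word.\<close>

lemma words_above_prod_list:
  "fs \<noteq> [] \<Longrightarrow> set fs \<subseteq> carrier free_alg \<Longrightarrow> prod_list fs \<in> words_above (length fs - 1)"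
proof (induction fs rule: list_nonempty_induct)
  case (cons f fs)
  then have "f \<in> words_above 0" "prod_list fs \<in> words_above (length fs - 1)"
    by (simp_all flip: carrier_eq_words_above)
  from words_above_mult_le[OF this] show ?case
    using cons.hyps by simp
qed (simp flip: carrier_eq_words_above)

lemma zero_words_above: "0 \<in> words_above N"
  by (simp add: words_above_def)

lemma words_above_add: "p \<in> words_above N \<Longrightarrow> q \<in> words_above N \<Longrightarrow> p + q \<in> words_above N"
  using keys_add[of p q] by (auto simp: words_above_def)

lemma words_above_scale: "p \<in> words_above N \<Longrightarrow> scale c p \<in> words_above N"
  by (auto simp: words_above_def in_keys_iff)

lemma words_above_sum: "(\<And>a. a \<in> A \<Longrightarrow> F a \<in> words_above N) \<Longrightarrow> sum F A \<in> words_above N"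
  by (induction A rule: infinite_finite_induct) (auto intro: words_above_add zero_words_above)

text \<open>Substituting elements without constant term never shortens a word. This uses that the
  algebra has no unit.\<close>

lemma free_T_ideal_words_above: "free_T_ideal (words_above N :: 'k::field_char_0 ncpoly set)"
proof (rule free_T_idealI)
  fix a x :: "'k ncpoly" assume a: "a \<in> words_above N" and "x \<in> carrier free_alg"
  then have x: "x \<in> words_above 0"
    by (simp only: carrier_eq_words_above)
  show "x * a \<in> words_above N \<and> a * x \<in> words_above N"
    using words_above_mult_le[OF a x] words_above_mult_le[OF x a] words_above_antimono[of N "N + 1"] by auto
next
  fix a :: "'k ncpoly" and \<phi> :: "nat \<Rightarrow> 'k ncpoly"
  assume a: "a \<in> words_above N" and \<phi>: "\<And>i. \<phi> i \<in> carrier free_alg"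
  have "prod_list (map \<phi> (letters w)) \<in> words_above N" if "w \<in> Poly_Mapping.keys a" for w
  proof -
    have "N < length (letters w)"
      using a that by (simp add: words_above_def)
    then show ?thesis
      using words_above_prod_list[of "map \<phi> (letters w)"] \<phi> words_above_antimono[of N "length (letters w) - 1"]
      by fastforce
  qed
  then show "substitute \<phi> a \<in> words_above N"
    unfolding substitute_def linear_ext_def by (intro words_above_sum words_above_scale)
qed (intro words_above_carrier zero_words_above words_above_add words_above_scale; assumption)+

section \<open>The commutative polynomial algebra, with multisets of letters as monomials, and its
  identities\<close>

definition poly_alg :: "('k::field, nat multiset \<Rightarrow>\<^sub>0 'k) module" where
  "poly_alg = \<lparr>carrier = UNIV, monoid.mult = (*), one = 1, zero = 0, add = (+),
     module.smult = (\<lambda>c p. Poly_Mapping.single 0 c * p)\<rparr>"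

lemma assoc_algebra_poly_alg: "assoc_algebra (poly_alg :: ('k::field, nat multiset \<Rightarrow>\<^sub>0 'k) module)"
proof -
  have "abelian_group (poly_alg :: ('k::field, nat multiset \<Rightarrow>\<^sub>0 'k) module)"
  proof (rule abelian_groupI)
    show "\<exists>y\<in>carrier poly_alg. y \<oplus>\<^bsub>poly_alg\<^esub> x = \<zero>\<^bsub>poly_alg\<^esub>"
      for x :: "nat multiset \<Rightarrow>\<^sub>0 'k"
      by (intro bexI[of _ "- x"]) (auto simp: poly_alg_def)
  qed (auto simp: poly_alg_def algebra_simps)
  then have "module (ring_of_type_algebra :: 'k ring) (poly_alg :: ('k, nat multiset \<Rightarrow>\<^sub>0 'k) module)"
    by (intro moduleI cring_from_type_algebra)
      (auto simp: poly_alg_def ring_of_type_algebra_simps algebra_simps single_add mult_single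
        simp flip: mult.assoc)
  then show ?thesis
    by (intro assoc_algebra.intro assoc_algebra_axioms.intro)
      (auto simp: poly_alg_def algebra_simps)
qed

definition abelianize :: "'k::field ncpoly \<Rightarrow> nat multiset \<Rightarrow>\<^sub>0 'k" where
  "abelianize f = (\<Sum>w\<in>Poly_Mapping.keys f. Poly_Mapping.single (mset (letters w)) (Poly_Mapping.lookup f w))"

lemma abelianize_superset:
  assumes "finite A" "Poly_Mapping.keys f \<subseteq> A"
  shows "abelianize f = (\<Sum>w\<in>A. Poly_Mapping.single (mset (letters w)) (Poly_Mapping.lookup f w))"
  unfolding abelianize_def using assms by (intro sum.mono_neutral_left) (auto simp: in_keys_iff)

lemma abelianize_add: "abelianize (f + g) = abelianize f + abelianize g"
proof -
  let ?A = "Poly_Mapping.keys f \<union> Poly_Mapping.keys g"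
  have "Poly_Mapping.keys (f + g) \<subseteq> ?A"
    by (rule keys_add)
  then show ?thesis
    by (simp add: abelianize_superset[of ?A] lookup_add single_add sum.distrib)
qed

lemma abelianize_single: "abelianize (Poly_Mapping.single w c) = Poly_Mapping.single (mset (letters w)) c"
  by (subst abelianize_superset[of "{w}"]) auto

lemma abelianize_zero: "abelianize 0 = 0"
  by (simp add: abelianize_def)

lemma abelianize_mult: "abelianize (f * g) = abelianize f * abelianize g"
proof (induction f rule: ncpoly_induct)
  case (single u c)
  show ?case
    by (induction g rule: ncpoly_induct)
      (simp_all add: abelianize_zero abelianize_single abelianize_add mult_single plus_word_def distrib_left)
qed (simp_all add: abelianize_zero abelianize_add distrib_right)

lemma abelianize_hom: "abelianize \<in> alg_hom (free_alg :: ('k::field, 'k ncpoly) module) poly_alg"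
proof -
  have "abelianize (scale c f) = Poly_Mapping.single 0 c * abelianize f" for c :: 'k and f
    by (simp add: scale_def abelianize_mult abelianize_single zero_word_def)
  then show ?thesis
    by (simp add: alg_hom_def poly_alg_def abelianize_add abelianize_mult)
qed

text \<open>Quantifying over all homomorphisms to \<open>poly_alg\<close>, rather than asking for
  \<open>abelianize f = 0\<close>, makes this a T-ideal directly by
  \<open>satisfied_T_ideal\<close>.\<close>

definition commutative_identities :: "'k::field ncpoly set" where
  "commutative_identities = {f \<in> carrier free_alg. satisfies poly_alg f}"

lemma free_T_ideal_commutative_identities:
  "free_T_ideal (commutative_identities :: 'k::field_char_0 ncpoly set)"
  unfolding commutative_identities_def
  by (rule free_T_ideal.intro) (rule satisfied_T_ideal[OF assoc_algebra_poly_alg])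

lemma commutator_commutative_identities:
  "commutator (gen 0) (gen 1) \<in> (commutative_identities :: 'k::field ncpoly set)"
proof -
  \<comment> \<open>The difference is written with \<open>scale (- 1)\<close> because
    \<open>alg_hom\<close> speaks of sums, products and scalar multiples only.\<close>
  have "h (gen 0 * gen 1 + scale (- 1) (gen 1 * gen 0)) = 0"
    if h: "h \<in> alg_hom free_alg poly_alg" for h :: "'k ncpoly \<Rightarrow> nat multiset \<Rightarrow>\<^sub>0 'k"
  proof -
    have c: "gen 0 * gen 1 \<in> carrier free_alg" "gen 1 * gen 0 \<in> carrier free_alg"
      by (intro carrier_closed gen_carrier)+
    have "h (gen 0 * gen 1 + scale (- 1) (gen 1 * gen 0)) =
        h (gen 0 * gen 1) + Poly_Mapping.single 0 (- 1) * h (gen 1 * gen 0)"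
      using alg_homD(2)[OF h c(1), of "scale (- 1) (gen 1 * gen 0)"] alg_homD(4)[OF h c(2), of "- 1"]
        scale_carrier[OF c(2), of "- 1"] by (simp add: poly_alg_def)
    also have "\<dots> = h (gen 0) * h (gen 1) - h (gen 1) * h (gen 0)"
      using alg_homD(3)[OF h gen_carrier gen_carrier, of 0 1] alg_homD(3)[OF h gen_carrier gen_carrier, of 1 0]
      by (simp add: poly_alg_def single_uminus)
    finally show ?thesis
      by (simp add: mult.commute)
  qed
  then have "satisfies poly_alg (commutator (gen 0) (gen 1) :: 'k ncpoly)"
    by (simp add: satisfies_def commutator_def scale_minus scale_add) (simp add: poly_alg_def)
  then show ?thesis
    using carrier_closed(4)[OF gen_carrier gen_carrier] by (simp add: commutative_identities_def)
qed

lemma commutator_mem_commutative_identities: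
  fixes f g :: "'k::field_char_0 ncpoly"
  assumes "f \<in> carrier free_alg" "g \<in> carrier free_alg"
  shows "commutator f g \<in> commutative_identities"
  using free_T_ideal.substitute[OF free_T_ideal_commutative_identities
      commutator_commutative_identities, of "\<lambda>i. if i = 0 then f else g"] assms
  by (simp add: substitute_commutator substitute_gen)

section \<open>Reordering letters modulo a T-ideal\<close>

context free_T_ideal
begin

text \<open>The letter \<open>c\<close> passes the letters of \<open>xs\<close> one at a time, the
  last one first. Each exchange changes the word by some \<open>u[x,c]v\<close>, whose degree
  \<open>length u + length v + 2\<close> is that of the whole word, so \<open>swap\<close>
  applies.\<close>

lemma move_letter_mem:
  assumes swap: "\<And>u a b v. N < length u + length v + 2 \<Longrightarrow>
      ncmono u * commutator (gen a) (gen b) * ncmono v \<in> J"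
    and "N < length (u @ xs @ c # ys)"
  shows "ncmono (u @ xs @ c # ys) - ncmono (u @ c # xs @ ys) \<in> J"
  using assms(2)
proof (induction xs arbitrary: u)
  case (Cons x xs)
  have IH: "ncmono ((u @ [x]) @ xs @ c # ys) - ncmono ((u @ [x]) @ c # xs @ ys) \<in> J"
    using Cons.prems by (intro Cons.IH) simp
  have mem: "ncmono u * commutator (gen x) (gen c) * ncmono (xs @ ys) \<in> J"
    using Cons.prems by (intro swap) simp
  have eq: "ncmono u * commutator (gen x) (gen c) * ncmono (xs @ ys) =
      ncmono (u @ x # c # xs @ ys) - ncmono (u @ c # x # xs @ ys)"
    by (simp add: commutator_def gen_def algebra_simps flip: ncmono_append)
  show ?case
    using add[OF IH mem[unfolded eq]] by simp
qed (simp add: zero)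

text \<open>The first letter of \<open>xs\<close> is brought to the front of \<open>ys\<close> and
  then joins a common prefix, after which the tails are compared. The prefix is kept in the
  induction because the degree bound concerns the whole word.\<close>

lemma permuted_word_mem:
  assumes swap: "\<And>u a b v. N < length u + length v + 2 \<Longrightarrow>
      ncmono u * commutator (gen a) (gen b) * ncmono v \<in> J"
    and "mset xs = mset ys" "N < length xs"
  shows "ncmono xs - ncmono ys \<in> J"
proof -
  have "ncmono (u @ xs) - ncmono (u @ ys) \<in> J" if "mset xs = mset ys" "N < length (u @ xs)" for u
    using that
  proof (induction xs arbitrary: u ys)
    case (Cons x xs)
    then have "x \<in> set ys"
      by (metis list.set_intros(1) set_mset_mset)
    then obtain ys1 ys2 where ys: "ys = ys1 @ x # ys2"
      by (meson split_list)
    have m: "mset xs = mset (ys1 @ ys2)"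
      using Cons.prems(1) by (simp add: ys)
    then have l: "length xs = length (ys1 @ ys2)"
      by (rule mset_eq_length)
    have "ncmono ((u @ [x]) @ xs) - ncmono ((u @ [x]) @ ys1 @ ys2) \<in> J"
      using Cons.prems(2) by (intro Cons.IH m) simp
    moreover have "ncmono (u @ ys1 @ x # ys2) - ncmono (u @ x # ys1 @ ys2) \<in> J"
      using Cons.prems(2) l by (intro move_letter_mem[OF swap]) simp_all
    ultimately show ?case
      using diff by (fastforce simp: ys)
  qed (simp add: zero)
  from this[of "[]"] show ?thesis
    using assms(2,3) by simp
qed

text \<open>Modulo \<open>J\<close> every word of \<open>p\<close> may be replaced by its sorted
  rearrangement. Collecting equal sorted words gives the coefficients of the abelianization of
  \<open>p\<close>, and these are zero.\<close>

lemma commutative_identity_mem: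
  assumes swap: "\<And>u a b v. N < length u + length v + 2 \<Longrightarrow>
      ncmono u * commutator (gen a) (gen b) * ncmono v \<in> J"
    and p: "p \<in> commutative_identities" "p \<in> words_above N"
  shows "p \<in> J"
proof -
  let ?s = "\<lambda>w. mset (letters w)"
  let ?c = "Poly_Mapping.lookup p"
  let ?K = "Poly_Mapping.keys p"
  define q where "q = (\<Sum>w\<in>?K. scale (?c w) (ncmono (sort (letters w))))"
  have "p - q = (\<Sum>w\<in>?K. scale (?c w) (ncmono (letters w) - ncmono (sort (letters w))))"
    by (subst ncpoly_as_ncmonos) (simp add: q_def scale_diff sum_subtractf)
  also have "\<dots> \<in> J"
    using p(2) by (intro sum scale permuted_word_mem[OF swap]) (auto simp: words_above_def)
  finally have "p - q \<in> J" .
  moreover have "q = 0"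
  proof -
    have "abelianize p = 0"
      using p(1) abelianize_hom by (auto simp: commutative_identities_def satisfies_def poly_alg_def)
    \<comment> \<open>Among the words of \<open>p\<close>, exactly those with letter multiset
      \<open>m\<close> are sent to the monomial \<open>m\<close>.\<close>
    then have coeff: "(\<Sum>w | w \<in> ?K \<and> ?s w = m. ?c w) = 0" for m
    proof -
      have "(\<Sum>w | w \<in> ?K \<and> ?s w = m. ?c w) = Poly_Mapping.lookup (abelianize p) m"
        by (simp add: abelianize_def lookup_sum lookup_single when_def sum.inter_filter)
      with \<open>abelianize p = 0\<close> show ?thesis
        by simp
    qed
    have "q = (\<Sum>m\<in>?s ` ?K. \<Sum>w | w \<in> ?K \<and> ?s w = m. scale (?c w) (ncmono (sort (letters w))))"
      unfolding q_def by (subst sum.group[symmetric, of ?K "?s ` ?K" ?s]) simp_all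
    also have "\<dots> = (\<Sum>m\<in>?s ` ?K. \<Sum>w | w \<in> ?K \<and> ?s w = m. scale (?c w) (ncmono (sorted_list_of_multiset m)))"
      by (intro sum.cong refl) auto
    also have "\<dots> = (\<Sum>m\<in>?s ` ?K. scale (\<Sum>w | w \<in> ?K \<and> ?s w = m. ?c w) (ncmono (sorted_list_of_multiset m)))"
      by (intro sum.cong poly_mapping_eqI) (simp_all add: lookup_sum sum_distrib_right)
    finally show ?thesis
      by (simp add: coeff scale_def)
  qed
  ultimately show ?thesis
    by simp
qed

end

section \<open>T-ideals of a relatively free algebra\<close>

locale free_quotient = free_T_ideal I for I :: "'k::field_char_0 ncpoly set"
begin

sublocale quot: alg_ideal_pair free_alg I
  using T_ideal
  by (intro alg_ideal_pair.intro alg_ideal_pair_axioms.intro assoc_algebra_free_alg) (simp add: T_ideal_def)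

abbreviation Q :: "('k, 'k ncpoly set) module" where
  "Q \<equiv> quot_alg free_alg I"

lemmas cls_carrier = quot.quot_alg_simps(1)
lemmas cls_zero = quot.quot_alg_simps(2)[unfolded free_alg_simps(4)]
lemmas cls_add = quot.quot_alg_simps(3)[unfolded free_alg_simps(3), symmetric]
lemmas cls_mult = quot.quot_alg_simps(4)[unfolded free_alg_simps(2), symmetric]
lemmas cls_scale = quot.quot_alg_simps(5)[unfolded free_alg_simps(5), symmetric]

sublocale Q: assoc_algebra Q
  by (rule quot.assoc_algebra_quot_alg)

lemma cls_eq_iff:
  assumes "p \<in> carrier free_alg" "q \<in> carrier free_alg"
  shows "quot.cls p = quot.cls q \<longleftrightarrow> p - q \<in> I"
proof
  have c: "scale (- 1) q \<in> carrier free_alg" "p - q \<in> carrier free_alg"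
    by (intro scale_carrier carrier_closed assms)+
  have eq: "p - q = p + scale (- 1) q" "0 = q + scale (- 1) q"
    by (simp_all add: scale_minus scale_add)
  assume "quot.cls p = quot.cls q"
  then have "quot.cls (p - q) = quot.cls 0"
    unfolding eq by (simp only: cls_add[OF assms(1) c(1)] cls_add[OF assms(2) c(1)])
  then show "p - q \<in> I"
    using quot.cls_eq_zero_iff[OF c(2)] by (simp add: cls_zero)
next
  assume "p - q \<in> I"
  from quot.cls_add_ideal[OF this assms(2)] show "quot.cls p = quot.cls q"
    by simp
qed

lemma T_ideal_image:
  assumes J: "free_T_ideal J" and "I \<subseteq> J"
  shows "T_ideal Q (quot.cls ` J)"
proof -
  interpret J: free_T_ideal J by fact
  note JC = J.subset_carrier[THEN subsetD]
  have "alg_ideal Q (quot.cls ` J)"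
    unfolding Q.alg_ideal_iff
  proof (intro conjI ballI allI)
    show "quot.cls ` J \<subseteq> carrier Q"
      unfolding cls_carrier by (intro image_mono J.subset_carrier)
    show "\<zero>\<^bsub>Q\<^esub> \<in> quot.cls ` J"
      unfolding cls_zero by (intro imageI J.zero)
    show "a \<oplus>\<^bsub>Q\<^esub> b \<in> quot.cls ` J" if ab: "a \<in> quot.cls ` J" "b \<in> quot.cls ` J" for a b
    proof -
      obtain i j where ij: "a = quot.cls i" "i \<in> J" "b = quot.cls j" "j \<in> J"
        using ab by blast
      then have "a \<oplus>\<^bsub>Q\<^esub> b = quot.cls (i + j)"
        by (simp only: cls_add JC)
      then show ?thesis
        using J.add[OF ij(2,4)] by simp
    qed
    show "c \<odot>\<^bsub>Q\<^esub> a \<in> quot.cls ` J" if a: "a \<in> quot.cls ` J" for a c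
    proof -
      obtain i where i: "a = quot.cls i" "i \<in> J"
        using a by blast
      then have "c \<odot>\<^bsub>Q\<^esub> a = quot.cls (scale c i)"
        by (simp only: cls_scale JC)
      then show ?thesis
        using J.scale[OF i(2)] by simp
    qed
    fix a x assume ax: "a \<in> quot.cls ` J" "x \<in> carrier Q"
    then show "x \<otimes>\<^bsub>Q\<^esub> a \<in> quot.cls ` J" "a \<otimes>\<^bsub>Q\<^esub> x \<in> quot.cls ` J"
    proof -
      obtain j y where jy: "a = quot.cls j" "j \<in> J" "x = quot.cls y" "y \<in> carrier free_alg"
        using ax unfolding cls_carrier by blast
      then have "x \<otimes>\<^bsub>Q\<^esub> a = quot.cls (y * j)" "a \<otimes>\<^bsub>Q\<^esub> x = quot.cls (j * y)"
        by (simp_all only: cls_mult JC)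
      then show "x \<otimes>\<^bsub>Q\<^esub> a \<in> quot.cls ` J" "a \<otimes>\<^bsub>Q\<^esub> x \<in> quot.cls ` J"
        using J.mult_left[OF jy(2,4)] J.mult_right[OF jy(2,4)] by simp_all
    qed
  qed
  moreover have "h ` quot.cls ` J \<subseteq> quot.cls ` J" if h: "h \<in> alg_hom Q Q" for h
  proof (intro image_subsetI)
    fix u assume "u \<in> quot.cls ` J"
    then obtain j where j: "j \<in> J" and u: "u = quot.cls j"
      by blast
    \<comment> \<open>An endomorphism of the quotient lifts to a substitution: choose
      representatives of the images of the generators. Both ways around the square agree on
      generators, hence everywhere.\<close>
    have "\<exists>r. r \<in> carrier free_alg \<and> h (quot.cls (gen i)) = quot.cls r" for i
      using alg_homD(1)[OF h, of "quot.cls (gen i)"] gen_carrier[of i] unfolding cls_carrier by blast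
    then obtain \<phi> where \<phi>: "\<And>i. \<phi> i \<in> carrier free_alg" "\<And>i. h (quot.cls (gen i)) = quot.cls (\<phi> i)"
      by metis
    have "h (quot.cls j) = quot.cls (substitute \<phi> j)"
      by (rule alg_hom_free_alg_eqI[OF Q.assoc_algebra_axioms alg_hom_comp[OF quot.cls_hom h]
            alg_hom_comp[OF substitute_hom[OF \<phi>(1)] quot.cls_hom]])
        (use JC[OF j] in \<open>simp_all add: substitute_gen \<phi>(2)\<close>)
    then show "h u \<in> quot.cls ` J"
      using J.substitute[OF j \<phi>(1)] by (simp add: u)
  qed
  ultimately show ?thesis
    unfolding T_ideal_def by (intro conjI ballI)
qed

text \<open>A T-ideal is closed under substitution, so the class of the result does not depend on
  the representative chosen by \<open>SOME\<close>. This is what lets invariance under endomorphisms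
  be pulled back along the projection.\<close>

lemma substitute_induces_hom:
  assumes \<phi>: "\<And>i. \<phi> i \<in> carrier free_alg"
  shows "\<exists>h\<in>alg_hom Q Q. \<forall>p\<in>carrier free_alg. h (quot.cls p) = quot.cls (substitute \<phi> p)"
proof -
  define h where "h C = quot.cls (substitute \<phi> (SOME p. p \<in> carrier free_alg \<and> quot.cls p = C))" for C
  note hom = substitute_hom[OF \<phi>]
  have h: "h (quot.cls p) = quot.cls (substitute \<phi> p)" if p: "p \<in> carrier free_alg" for p
  proof -
    define q where "q = (SOME q. q \<in> carrier free_alg \<and> quot.cls q = quot.cls p)"
    have q: "q \<in> carrier free_alg" "quot.cls q = quot.cls p"
      using someI[of "\<lambda>q. q \<in> carrier free_alg \<and> quot.cls q = quot.cls p" p] p by (auto simp: q_def)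
    then have "substitute \<phi> q - substitute \<phi> p \<in> I"
      using p substitute[OF _ \<phi>, of "q - p"] by (simp only: cls_eq_iff substitute_diff)
    then show ?thesis
      using alg_homD(1)[OF hom] p q(1) by (simp only: h_def cls_eq_iff flip: q_def)
  qed
  have "h \<in> alg_hom Q Q"
    using alg_homD(1)[OF hom]
    by (auto simp: alg_hom_def cls_carrier h lookup_add lookup_mult_zero_word
        substitute_add substitute_mult substitute_scale simp flip: cls_add cls_mult cls_scale)
  then show ?thesis
    by (rule bexI[rotated]) (intro ballI h)
qed

lemma free_T_ideal_preimage:
  assumes N: "T_ideal Q N"
  shows "free_T_ideal {p \<in> carrier free_alg. quot.cls p \<in> N}"
proof (rule free_T_idealI)
  have N': "\<zero>\<^bsub>Q\<^esub> \<in> N" "\<And>x y. x \<in> N \<Longrightarrow> y \<in> N \<Longrightarrow> x \<oplus>\<^bsub>Q\<^esub> y \<in> N" "\<And>x c. x \<in> N \<Longrightarrow> c \<odot>\<^bsub>Q\<^esub> x \<in> N"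
    "\<And>x y. x \<in> N \<Longrightarrow> y \<in> carrier Q \<Longrightarrow> y \<otimes>\<^bsub>Q\<^esub> x \<in> N" "\<And>x y. x \<in> N \<Longrightarrow> y \<in> carrier Q \<Longrightarrow> x \<otimes>\<^bsub>Q\<^esub> y \<in> N"
    using N unfolding T_ideal_def Q.alg_ideal_iff by blast+
  let ?M = "{p \<in> carrier free_alg. quot.cls p \<in> N}"
  show "0 \<in> ?M"
    using N'(1) by (simp add: cls_zero)
  show "a + b \<in> ?M" if "a \<in> ?M" "b \<in> ?M" for a b
  proof -
    have ab: "a \<in> carrier free_alg" "b \<in> carrier free_alg" "quot.cls a \<in> N" "quot.cls b \<in> N"
      using that by auto
    show ?thesis
      using N'(2)[OF ab(3,4)] carrier_closed(2)[OF ab(1,2)] by (simp only: cls_add[OF ab(1,2)] mem_Collect_eq)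
  qed
  show "scale c a \<in> ?M" if "a \<in> ?M" for a c
  proof -
    have a: "a \<in> carrier free_alg" "quot.cls a \<in> N"
      using that by auto
    show ?thesis
      using N'(3)[OF a(2)] scale_carrier[OF a(1)] by (simp only: cls_scale[OF a(1)] mem_Collect_eq)
  qed
  show "x * a \<in> ?M \<and> a * x \<in> ?M" if "a \<in> ?M" and x: "x \<in> carrier free_alg" for a x
  proof -
    have a: "a \<in> carrier free_alg" "quot.cls a \<in> N"
      using that by auto
    have "quot.cls x \<in> carrier Q"
      unfolding cls_carrier using x by (rule imageI)
    from N'(4,5)[OF a(2) this] show ?thesis
      using carrier_closed(1)[OF a(1) x] carrier_closed(1)[OF x a(1)]
      by (simp only: cls_mult[OF a(1) x] cls_mult[OF x a(1)] mem_Collect_eq)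
  qed
  show "substitute \<phi> a \<in> ?M"
    if "a \<in> ?M" and \<phi>: "\<And>i. \<phi> i \<in> carrier free_alg" for a \<phi>
  proof -
    have a: "a \<in> carrier free_alg" "quot.cls a \<in> N"
      using that(1) by auto
    obtain h where h: "h \<in> alg_hom Q Q"
      "\<And>p. p \<in> carrier free_alg \<Longrightarrow> h (quot.cls p) = quot.cls (substitute \<phi> p)"
      using substitute_induces_hom[of \<phi>, OF \<phi>] by blast
    have "h ` N \<subseteq> N"
      using N h(1) by (simp add: T_ideal_def)
    then have "quot.cls (substitute \<phi> a) \<in> N"
      using a(2) by (simp only: h(2)[OF a(1), symmetric]) blast
    then show ?thesis
      using alg_homD(1)[OF substitute_hom[OF \<phi>] a(1)] by simp
  qed
qed auto

text \<open>The image of a T-ideal containing \<open>I\<close> is a T-ideal of the quotient, and so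
  is the preimage of one in the free algebra; the two facts give the two inclusions. Questions about
  the relatively free algebra thereby move to the free algebra.\<close>

lemma T_ideal_gen_quotient:
  assumes G: "G \<subseteq> carrier free_alg"
  shows "T_ideal_gen Q (quot.cls ` G) = quot.cls ` T_ideal_gen free_alg (I \<union> G)"
proof
  have IG: "I \<union> G \<subseteq> carrier free_alg"
    using G subset_carrier by simp
  show "T_ideal_gen Q (quot.cls ` G) \<subseteq> quot.cls ` T_ideal_gen free_alg (I \<union> G)"
    using T_ideal_gen_incl[of "I \<union> G" free_alg]
    by (intro T_ideal_gen_least T_ideal_image free_T_ideal_gen[OF IG]) auto
  show "quot.cls ` T_ideal_gen free_alg (I \<union> G) \<subseteq> T_ideal_gen Q (quot.cls ` G)"
    unfolding T_ideal_gen_def[of Q]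
  proof (rule Inter_greatest)
    fix N assume "N \<in> {N. T_ideal Q N \<and> quot.cls ` G \<subseteq> N}"
    then have N: "T_ideal Q N" "quot.cls ` G \<subseteq> N"
      by auto
    have "\<zero>\<^bsub>Q\<^esub> \<in> N"
      using N(1) by (simp add: T_ideal_def Q.alg_ideal_iff)
    moreover have "quot.cls p = \<zero>\<^bsub>Q\<^esub>" if "p \<in> I" for p
      using that subset_carrier quot.cls_eq_zero_iff[of p] by blast
    ultimately have "I \<union> G \<subseteq> {p \<in> carrier free_alg. quot.cls p \<in> N}"
      using N(2) IG by (intro subsetI) (auto simp: image_subset_iff)
    then have "T_ideal_gen free_alg (I \<union> G) \<subseteq> {p \<in> carrier free_alg. quot.cls p \<in> N}"
      by (intro T_ideal_gen_least free_T_ideal.T_ideal free_T_ideal_preimage N)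
    then show "quot.cls ` T_ideal_gen free_alg (I \<union> G) \<subseteq> N"
      by blast
  qed
qed

end

text \<open>Applied to \<open>words_above n\<close> and the identities of the variety, this shows
  that generators of high degree produce only elements of high degree up to identities.\<close>

lemma free_T_ideal_sum:
  fixes I J :: "'k::field_char_0 ncpoly set"
  assumes "free_T_ideal I" "free_T_ideal J"
  shows "free_T_ideal {p + q | p q. p \<in> I \<and> q \<in> J}"
proof -
  interpret I: free_T_ideal I by fact
  interpret J: free_T_ideal J by fact
  define S where "S = {p + q | p q. p \<in> I \<and> q \<in> J}"
  have SI: "p + q \<in> S" if "p \<in> I" "q \<in> J" for p q
    using that unfolding S_def by blast
  have SE: "\<exists>p q. a = p + q \<and> p \<in> I \<and> q \<in> J" if "a \<in> S" for a
    using that unfolding S_def by blast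
  have "free_T_ideal S"
  proof (rule free_T_idealI)
    show "S \<subseteq> carrier free_alg"
    proof
      fix a assume "a \<in> S"
      then obtain p q where "a = p + q" "p \<in> I" "q \<in> J"
        using SE by blast
      then show "a \<in> carrier free_alg"
        using carrier_closed(2)[of p q] I.subset_carrier J.subset_carrier by blast
    qed
    show "0 \<in> S"
      using SI[OF I.zero J.zero] by simp
  next
    fix a b assume "a \<in> S" "b \<in> S"
    then obtain p q p' q' where ab: "a = p + q" "b = p' + q'" and m: "p \<in> I" "q \<in> J" "p' \<in> I" "q' \<in> J"
      using SE by meson
    have "(p + p') + (q + q') \<in> S"
      by (intro SI I.add J.add m)
    then show "a + b \<in> S"
      by (simp add: ab ac_simps)
  next
    fix a c assume "a \<in> S"
    then obtain p q where a: "a = p + q" and m: "p \<in> I" "q \<in> J"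
      using SE by meson
    show "scale c a \<in> S"
      unfolding a scale_add by (intro SI I.scale J.scale m)
  next
    fix a x :: "'k ncpoly" assume "a \<in> S" and x: "x \<in> carrier free_alg"
    then obtain p q where a: "a = p + q" and m: "p \<in> I" "q \<in> J"
      using SE by meson
    show "x * a \<in> S \<and> a * x \<in> S"
      unfolding a distrib_left distrib_right
      by (intro conjI SI I.mult_left J.mult_left I.mult_right J.mult_right m x)
  next
    fix a :: "'k ncpoly" and \<phi> :: "nat \<Rightarrow> 'k ncpoly" assume "a \<in> S" and \<phi>: "\<And>i. \<phi> i \<in> carrier free_alg"
    then obtain p q where a: "a = p + q" and m: "p \<in> I" "q \<in> J"
      using SE by meson
    show "substitute \<phi> a \<in> S"
      unfolding a substitute_add by (intro SI I.substitute J.substitute m \<phi>)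
  qed
  then show ?thesis
    by (simp only: S_def)
qed

section \<open>Higher consequences described in the free algebra\<close>

context
  fixes V :: "('k::field_char_0, 'k ncpoly set) module set"
  assumes V: "free_T_ideal (identities V)"
begin

interpretation free_quotient "identities V"
  by (intro free_quotient.intro V)

lemma higher_consequences_eq:
  assumes f: "f \<in> carrier free_alg"
  shows "higher_consequences V n f =
    proj V ` (T_ideal_gen free_alg (insert f (identities V)) \<inter> words_above n)"
proof -
  let ?J = "T_ideal_gen free_alg (insert f (identities V))"
  interpret J: free_T_ideal ?J
    using f subset_carrier by (intro free_T_ideal_gen) simp
  have IJ: "identities V \<subseteq> ?J"
    using T_ideal_gen_incl by fast
  have gen: "T_ideal_gen (rel_free V) {proj V f} = proj V ` ?J"
    using T_ideal_gen_quotient[of "{f}"] f by (simp add: rel_free_def proj_def)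
  \<comment> \<open>\<open>?J\<close> contains the identities and is therefore a union of cosets, so
    the representative of high degree required by \<open>higher_consequences\<close> lies in
    \<open>?J\<close> itself.\<close>
  have mem: "p \<in> ?J" if "q \<in> ?J" "p \<in> carrier free_alg" "proj V p = proj V q" for p q
  proof -
    have "p - q \<in> ?J"
      using that cls_eq_iff J.subset_carrier IJ unfolding proj_def by blast
    from J.add[OF this that(1)] show ?thesis
      by simp
  qed
  show ?thesis
  proof (intro equalityI subsetI)
    fix u assume "u \<in> higher_consequences V n f"
    then obtain p q where "q \<in> ?J" "p \<in> carrier free_alg" "proj V p = proj V q"
        "u = proj V p" "p \<in> words_above n"
      by (auto simp: higher_consequences_def gen words_above_def)
    with mem show "u \<in> proj V ` (?J \<inter> words_above n)"
      by blast
  next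
    fix u assume "u \<in> proj V ` (?J \<inter> words_above n)"
    then obtain p where "p \<in> ?J" "p \<in> words_above n" "u = proj V p"
      by blast
    moreover then have "p \<in> carrier free_alg"
      using words_above_carrier by blast
    ultimately show "u \<in> higher_consequences V n f"
      by (auto simp: higher_consequences_def gen words_above_def)
  qed
qed

lemma no_higher_consequencesI:
  assumes f: "f \<in> carrier free_alg"
    and "T_ideal_gen free_alg (insert f (identities V)) \<inter> words_above n \<subseteq> identities V"
  shows "no_higher_consequences V n f"
proof -
  have sub: "insert f (identities V) \<subseteq> carrier free_alg"
    using f subset_carrier by simp
  have "proj V p = \<zero>\<^bsub>rel_free V\<^esub>"
    if "p \<in> T_ideal_gen free_alg (insert f (identities V)) \<inter> words_above n" for p
    using that assms(2) subset_carrier quot.cls_eq_zero_iff[of p] by (auto simp: proj_def rel_free_def)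
  moreover have "0 \<in> T_ideal_gen free_alg (insert f (identities V)) \<inter> words_above n"
    using free_T_ideal.zero[OF free_T_ideal_gen[OF sub]] zero_words_above by blast
  ultimately show ?thesis
    unfolding no_higher_consequences_def higher_consequences_eq[OF f] by blast
qed

lemma higher_consequences_equivI:
  assumes f: "f \<in> carrier free_alg"
    and G: "G \<subseteq> words_above n" "G \<subseteq> T_ideal_gen free_alg (insert f (identities V))"
    and sub: "T_ideal_gen free_alg (insert f (identities V)) \<inter> words_above n
      \<subseteq> T_ideal_gen free_alg (identities V \<union> G)"
  shows "higher_consequences_equiv V n f G"
proof -
  let ?Jf = "T_ideal_gen free_alg (insert f (identities V))"
  let ?JG = "T_ideal_gen free_alg (identities V \<union> G)"
  interpret Jf: free_T_ideal ?Jf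
    using f subset_carrier by (intro free_T_ideal_gen) simp
  have If: "identities V \<subseteq> ?Jf"
    using T_ideal_gen_incl by fast
  have "?JG \<subseteq> ?Jf"
    using If G(2) by (intro T_ideal_gen_least Jf.T_ideal) simp
  \<comment> \<open>An element of \<open>?JG\<close> may have low-degree terms, but they can be
    removed by subtracting an identity: \<open>?S\<close> is a T-ideal containing all generators of
    \<open>?JG\<close>.\<close>
  let ?S = "{p + q | p q. p \<in> words_above n \<and> q \<in> identities V}"
  have "identities V \<union> G \<subseteq> ?S"
    using G(1) zero zero_words_above by force
  then have S: "?JG \<subseteq> ?S"
    by (intro T_ideal_gen_least free_T_ideal.T_ideal free_T_ideal_sum free_T_ideal_words_above V)
  have "proj V ` ?JG \<subseteq> proj V ` (?Jf \<inter> words_above n)"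
  proof
    fix u assume "u \<in> proj V ` ?JG"
    then obtain r where r: "r \<in> ?JG" "u = proj V r"
      by blast
    then obtain p q where pq: "r = p + q" "p \<in> words_above n" "q \<in> identities V"
      using S by blast
    have "p = r - q"
      by (simp add: pq(1))
    then have "p \<in> ?Jf"
      using r(1) pq(3) \<open>?JG \<subseteq> ?Jf\<close> If Jf.diff by blast
    moreover have "proj V r = proj V p"
      unfolding proj_def using r(1) pq \<open>?JG \<subseteq> ?Jf\<close> Jf.subset_carrier \<open>p \<in> ?Jf\<close>
      by (subst cls_eq_iff) auto
    ultimately show "u \<in> proj V ` (?Jf \<inter> words_above n)"
      using r(2) pq(2) by blast
  qed
  moreover have "G \<subseteq> carrier free_alg"
    using G(1) words_above_carrier by blast
  then have "T_ideal_gen (rel_free V) (proj V ` G) = proj V ` ?JG"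
    using T_ideal_gen_quotient[of G] by (simp add: rel_free_def proj_def)
  ultimately show ?thesis
    unfolding higher_consequences_equiv_def higher_consequences_eq[OF f] using sub by auto
qed

end

section \<open>Linearization of a power\<close>

lemma ncmono_Cons: "ncmono (i # xs) = gen i * ncmono xs"
  using ncmono_append[of "[i]" xs] by (simp add: gen_def)

lemma power_sum_gen:
  assumes "finite A"
  shows "(\<Sum>i\<in>A. gen i :: 'k::field ncpoly) ^ m = (\<Sum>xs | set xs \<subseteq> A \<and> length xs = m. ncmono xs)"
proof (induction m)
  case 0
  have "{xs. set xs \<subseteq> A \<and> length xs = 0} = {[]}"
    by auto
  then show ?case
    by (simp add: ncmono_Nil)
next
  case (Suc m)
  let ?L = "{xs. set xs \<subseteq> A \<and> length xs = m}"
  have "(\<Sum>xs | set xs \<subseteq> A \<and> length xs = Suc m. ncmono xs :: 'k ncpoly) =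
      (\<Sum>(xs, i)\<in>?L \<times> A. ncmono (i # xs))"
    unfolding lists_length_Suc_eq by (subst sum.reindex) (auto simp: inj_on_def case_prod_unfold)
  also have "\<dots> = (\<Sum>i\<in>A. gen i) * (\<Sum>xs\<in>?L. ncmono xs)"
    by (simp add: ncmono_Cons sum_product sum.swap[of _ A ?L] flip: sum.cartesian_product)
  finally show ?case
    by (simp add: Suc.IH)
qed

lemma of_nat_mult_eq_scale: "of_nat m * f = scale (of_nat m) f"
proof (induction m)
  case 0
  show ?case
    by (rule poly_mapping_eqI) simp
qed (simp add: scale_add distrib_right)

lemma substitute_power: "substitute \<phi> (f ^ m) = substitute \<phi> f ^ m"
  using substitute_ncmono[of \<phi> "[]"] by (induction m) (simp_all add: substitute_mult ncmono_Nil)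

context free_T_ideal
begin

text \<open>
  Substituting 0 for the generator \<open>k\<close> and subtracting removes the words without the letter \<open>k\<close>;
  doing so for all \<open>k < n\<close> isolates the multilinear part of \<open>(x\<^sub>0 + \<dots> + x\<^sub>n\<^sub>-\<^sub>1)\<^sup>n\<close>.
\<close>

lemma linearized_power_mem:
  assumes power: "gen 0 ^ n \<in> J"
  shows "(\<Sum>xs\<in>permutations_of_set {..<n}. ncmono xs) \<in> J"
proof -
  define L where "L = {xs. set xs \<subseteq> {..<n} \<and> length xs = n}"
  have fin: "finite L"
    unfolding L_def by (intro finite_lists_length_eq) simp
  have "(\<Sum>xs | xs \<in> L \<and> {..<k} \<subseteq> set xs. ncmono xs) \<in> J" if "k \<le> n" for k
    using that
  proof (induction k)
    case 0
    have "(\<Sum>i<n. gen i) \<in> carrier free_alg"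
      unfolding carrier_eq_words_above
      by (intro words_above_sum gen_carrier[unfolded carrier_eq_words_above])
    \<comment> \<open>Sending \<open>gen 0\<close> to the sum of \<open>n\<close> generators expands
      the power into all words of length \<open>n\<close> in these letters.\<close>
    then have "substitute (\<lambda>_. \<Sum>i<n. gen i) (gen 0 ^ n) \<in> J"
      by (intro substitute power)
    then show ?case
      by (simp add: substitute_power substitute_gen power_sum_gen L_def)
  next
    case (Suc k)
    let ?\<phi> = "\<lambda>j. if j = k then 0 else gen j"
    let ?A = "{xs. xs \<in> L \<and> {..<k} \<subseteq> set xs}"
    have \<phi>: "substitute ?\<phi> (ncmono xs) = (if k \<in> set xs then 0 else ncmono xs)" for xs
      unfolding substitute_ncmono by (induction xs) (auto simp: ncmono_Nil ncmono_Cons)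
    have mem: "(\<Sum>xs\<in>?A. ncmono xs) \<in> J"
      using Suc by simp
    have "substitute ?\<phi> (\<Sum>xs\<in>?A. ncmono xs) \<in> J"
      by (intro substitute mem) (simp add: gen_carrier[simplified])
    from diff[OF mem this] have "(\<Sum>xs\<in>?A. if k \<in> set xs then ncmono xs else 0) \<in> J"
      by (simp add: substitute_sum \<phi> if_distrib[of "\<lambda>x. _ - x"] flip: sum_subtractf cong: if_cong)
    also have "(\<Sum>xs\<in>?A. if k \<in> set xs then ncmono xs else 0) = (\<Sum>xs | xs \<in> ?A \<and> k \<in> set xs. ncmono xs)"
      using fin by (intro sum.inter_filter[symmetric]) simp
    also have "{xs. xs \<in> ?A \<and> k \<in> set xs} = {xs. xs \<in> L \<and> {..<Suc k} \<subseteq> set xs}"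
      by (auto simp: lessThan_Suc)
    finally show ?case .
  qed
  from this[of n] have "(\<Sum>xs | xs \<in> L \<and> {..<n} \<subseteq> set xs. ncmono xs) \<in> J"
    by simp
  \<comment> \<open>A word with \<open>n\<close> entries that contains all \<open>n\<close> letters
    cannot repeat any of them.\<close>
  also have "{xs. xs \<in> L \<and> {..<n} \<subseteq> set xs} = permutations_of_set {..<n}"
  proof -
    have "distinct xs" if "set xs = {..<n}" "length xs = n" for xs :: "nat list"
      using that by (intro card_distinct) simp
    then show ?thesis
      by (auto simp: L_def permutations_of_set_def distinct_card dest: distinct_card)
  qed
  finally show ?thesis .
qed

end

section \<open>Commuting letters and nilpotency modulo the defining identity\<close>

context variety_T_ideal
begin

text \<open>At least two letters surround the commutator. They lie all to the right, all to the
  left, or on both sides, and each position is one of the three degree four results with the spare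
  letters gathered into one factor.\<close>

lemma swap_letters_mem:
  assumes "3 < length u + length v + 2"
  shows "ncmono u * commutator (gen a) (gen b) * ncmono v \<in> J"
proof -
  consider "u = []" | "v = []" | "u \<noteq> []" "v \<noteq> []"
    by blast
  then show ?thesis
  proof cases
    case 1
    then obtain c v' where "v = c # v'" "v' \<noteq> []"
      using assms by (cases v) auto
    then show ?thesis
      using commutator_mult_mem[OF gen_carrier gen_carrier gen_carrier ncmono_carrier]
      by (simp add: 1 ncmono_Nil ncmono_Cons flip: mult.assoc)
  next
    case 2
    then obtain c u' where "u = c # u'" "u' \<noteq> []"
      using assms by (cases u) auto
    then show ?thesis
      using mult_commutator_mem[OF gen_carrier ncmono_carrier gen_carrier gen_carrier]
      by (simp add: 2 ncmono_Nil ncmono_Cons)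
  next
    case 3
    then show ?thesis
      by (intro mult_commutator_mult_mem gen_carrier ncmono_carrier)
  qed
qed

text \<open>One neighbouring letter now suffices: on the right the assumption applies, on the left
  \<open>left_commutator_mem\<close>.\<close>

lemma swap_letters_mem':
  assumes "commutator (gen 0) (gen 1) * gen 2 \<in> J" "2 < length u + length v + 2"
  shows "ncmono u * commutator (gen a) (gen b) * ncmono v \<in> J"
proof -
  have right: "commutator x y * z \<in> J"
    if "x \<in> carrier free_alg" "y \<in> carrier free_alg" "z \<in> carrier free_alg" for x y z
    using substitute[OF assms(1), of "\<lambda>i. if i = 0 then x else if i = 1 then y else z"] that
    by (simp add: substitute_mult substitute_commutator substitute_gen)
  show ?thesis
  proof (cases "u = []")
    case True
    then have "v \<noteq> []"
      using assms(2) by auto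
    then show ?thesis
      using right[OF gen_carrier gen_carrier ncmono_carrier] by (simp add: True ncmono_Nil)
  next
    case False
    have "ncmono u * commutator (gen a) (gen b) \<in> J"
      by (intro left_commutator_mem right gen_carrier ncmono_carrier False)
    then show ?thesis
      using mult_right[OF _ ncmono_carrier[of v]] by (cases "v = []") (simp_all add: ncmono_Nil)
  qed
qed

lemma nilpotent_mem:
  assumes power: "gen 0 ^ n \<in> J" and "n > 0"
  shows "ncmono [0..<n + 1] \<in> J"
proof -
  consider "n = 1" | "n = 2" | "n \<ge> 3"
    using \<open>n > 0\<close> by linarith
  then show ?thesis
  proof cases
    case 1
    then show ?thesis
      using mult_right[OF power gen_carrier[of 1]] by (simp add: upt_rec ncmono_Cons ncmono_Nil)
  next
    case 2
    \<comment> \<open>The words in question have degree 3, below the range of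
      \<open>swap_letters_mem\<close>, so the square is polarized instead.\<close>
    have anti: "x * y + y * x \<in> J" if "x \<in> carrier free_alg" "y \<in> carrier free_alg" for x y
    proof -
      have "a * a \<in> J" if "a \<in> carrier free_alg" for a
        using substitute[OF power, of "\<lambda>_. a"] that by (simp add: 2 substitute_mult substitute_gen power2_eq_square)
      then have "(x + y) * (x + y) - x * x - y * y \<in> J"
        by (intro diff) (use that carrier_closed(2) in blast)+
      then show ?thesis
        by (simp add: algebra_simps)
    qed
    let ?x = "gen 0" and ?y = "gen 1" and ?z = "gen 2"
    \<comment> \<open>Every parenthesis on the right is an anticommutator, the first one of
      \<open>?x * ?y\<close> with \<open>?z\<close>.\<close>
    have "scale 2 (?x * ?y * ?z) = (?x * ?y * ?z + ?z * (?x * ?y)) - (?z * ?x + ?x * ?z) * ?y + ?x * (?z * ?y + ?y * ?z)"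
      by (rule poly_mapping_eqI) (simp add: lookup_add lookup_minus algebra_simps)
    also have "\<dots> \<in> J"
      by (intro add diff anti mult_left mult_right carrier_closed(1) gen_carrier)
    finally have "?x * ?y * ?z \<in> J"
      by (simp add: scale_iff)
    then show ?thesis
      by (simp add: 2 upt_rec ncmono_Cons ncmono_Nil mult.assoc numeral_2_eq_2)
  next
    case 3
    let ?P = "permutations_of_set {..<n}"
    \<comment> \<open>The appended letter raises the degree to \<open>n + 1\<close>, at least 4,
      where reordering is allowed. All \<open>fact n\<close> summands then agree modulo
      \<open>J\<close>, and \<open>fact n\<close> is invertible in characteristic 0.\<close>
    have perm: "ncmono (xs @ [n]) - ncmono [0..<n + 1] \<in> J" if xs: "xs \<in> ?P" for xs
    proof (rule permuted_word_mem[OF swap_letters_mem])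
      have "mset xs = mset_set {..<n}"
        using permutations_of_setD[OF xs] mset_set_set[of xs] by simp
      then show "mset (xs @ [n]) = mset [0..<n + 1]"
        by (simp add: atLeast0LessThan)
      show "3 < length (xs @ [n])"
        using permutations_of_setD[OF xs] 3 distinct_card[of xs] by simp
    qed
    have total: "(\<Sum>xs\<in>?P. ncmono (xs @ [n])) \<in> J"
      using mult_right[OF linearized_power_mem[OF power] gen_carrier[of n]]
      by (simp add: sum_distrib_right ncmono_append gen_def)
    have "(\<Sum>xs\<in>?P. ncmono (xs @ [n]) - ncmono [0..<n + 1]) \<in> J"
      by (intro sum perm)
    from diff[OF total this]
    have "(\<Sum>xs\<in>?P. ncmono (xs @ [n])) - (\<Sum>xs\<in>?P. ncmono (xs @ [n]) - ncmono [0..<n + 1]) \<in> J" .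
    then have "of_nat (fact n) * ncmono [0..<n + 1] \<in> J"
      by (simp add: sum_subtractf del: upt_Suc)
    then have "scale (of_nat (fact n)) (ncmono [0..<n + 1]) \<in> J"
      by (simp only: of_nat_mult_eq_scale)
    then show ?thesis
      by (simp only: scale_iff of_nat_eq_0_iff fact_nonzero not_False_eq_True)
  qed
qed

end

text \<open>A word longer than \<open>n\<close> is a value of the product of the first
  \<open>n + 1\<close> generators: the last one takes the whole tail.\<close>

lemma words_above_subset_T_ideal:
  fixes J :: "'k::field_char_0 ncpoly set"
  assumes "free_T_ideal J" "ncmono [0..<n + 1] \<in> J"
  shows "words_above n \<subseteq> J"
proof
  interpret free_T_ideal J by fact
  fix p :: "'k ncpoly" assume p: "p \<in> words_above n"
  have "ncmono xs \<in> J" if xs: "n < length xs" for xs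
  proof -
    \<comment> \<open>Indices beyond \<open>n\<close> do not occur in the product; whatever
      \<open>xs ! i\<close> is there, the image is a generator and lies in the carrier.\<close>
    let ?\<phi> = "\<lambda>i. if i = n then ncmono (drop n xs) else gen (xs ! i) :: 'k ncpoly"
    have "map ?\<phi> [0..<n] = map gen (take n xs)"
      using xs by (intro nth_equalityI) auto
    then have "prod_list (map ?\<phi> [0..<n]) = ncmono (take n xs)"
      by (simp only: prod_list_map_gen)
    then have "substitute ?\<phi> (ncmono [0..<n + 1]) = ncmono (take n xs) * ncmono (drop n xs)"
      by (simp add: substitute_ncmono)
    moreover have "substitute ?\<phi> (ncmono [0..<n + 1]) \<in> J"
      using xs by (intro substitute assms(2)) (simp add: gen_carrier ncmono_carrier del: free_alg_simps)
    ultimately show ?thesis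
      by (simp flip: ncmono_append)
  qed
  then show "p \<in> J"
    by (subst ncpoly_as_ncmonos, intro sum scale) (use p in \<open>simp add: words_above_def\<close>)
qed

text \<open>The cyclic sum of commutator products makes it evident that the polynomial vanishes on
  commutative algebras.\<close>

lemma standard_poly_3:
  "standard_poly 3 = commutator (gen 0) (gen 1) * gen 2 + commutator (gen 1) (gen 2) * gen 0
     + commutator (gen 2) (gen 0) * gen 1"
proof -
  have three: "{..<3::nat} = insert 0 (insert 1 (insert 2 {}))"
    by auto
  have f: "finite {2::nat}" "1 \<notin> {2::nat}" "finite {1, 2::nat}" "0 \<notin> {1, 2::nat}" "finite {}" "2 \<notin> {}"
    by auto
  show ?thesis
    unfolding standard_poly_def three
    unfolding sum_over_permutations_insert[OF f(3,4)] sum_over_permutations_insert[OF f(1,2)] permutes_sing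
    by (simp add: sign_compose sign_swap_id permutation_swap_id upt_rec transpose_def numeral_2_eq_2 scale_minus scale_add
        commutator_def ncmono_Cons ncmono_Nil algebra_simps)
qed

text \<open>A single word occurring in \<open>f\<close> determines \<open>n\<close>, which is how
  cases (b) and (c) obtain the values 2 and 3.\<close>

lemma homogeneous_degree:
  "homogeneous n f \<Longrightarrow> Poly_Mapping.lookup f (Word xs) \<noteq> 0 \<Longrightarrow> length xs = n"
  unfolding homogeneous_def in_keys_iff[symmetric] by (metis word.sel)

theorem theorem2p1p2:
  fixes \<alpha> \<beta> :: "'k::field_char_0"
    and V :: "('k, 'k ncpoly set) module set"
    and f :: "'k ncpoly"
    and n :: nat
  assumes "\<alpha> * \<beta> * (\<alpha> - \<beta>) * (\<alpha> + \<beta>) \<noteq> 0"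
    and "V = variety {scale \<alpha> (commutator (gen 0) (gen 1) * gen 0)
                      + scale \<beta> (gen 0 * commutator (gen 0) (gen 1))}"
    and "homogeneous n f"
    and "irreducible_Sn_submodule V n (linearization_module V n f)"
  shows "(f = gen 0 ^ n \<longrightarrow> higher_consequences_equiv V n f {ncmono [0..<n + 1]}) \<and>
    (f = commutator (gen 0) (gen 1) \<longrightarrow>
       higher_consequences_equiv V n f {commutator (gen 0) (gen 1) * gen 2}) \<and>
    (f = commutator (gen 0) (gen 1) * gen 0 \<or> f = standard_poly 3 \<longrightarrow>
       no_higher_consequences V n f)"
proof -
  let ?x = "gen 0 :: 'k ncpoly" and ?y = "gen 1 :: 'k ncpoly" and ?z = "gen 2 :: 'k ncpoly"
  let ?K = "commutative_identities :: 'k ncpoly set"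
  define I where "I = identities V"
  have g: "basic_identity \<alpha> \<beta> ?x ?y \<in> carrier free_alg"
    unfolding basic_identity_def
    by (intro carrier_closed scale_carrier gen_carrier)
  then have I_eq: "I = T_ideal_gen free_alg {basic_identity \<alpha> \<beta> ?x ?y}"
    unfolding I_def assms(2) basic_identity_def by (intro identities_variety_eq) simp
  have I: "free_T_ideal I"
    unfolding I_eq using g by (intro free_T_ideal_gen) simp
  note V = I[unfolded I_def]
  have IC: "I \<subseteq> carrier free_alg"
    by (rule free_T_ideal.subset_carrier[OF I])
  \<comment> \<open>The reordering results hold for every T-ideal above \<open>I\<close>. They are
    applied to \<open>I\<close>, to the T-ideal generated by \<open>f\<close> over \<open>I\<close>,
    and in (b) to the one generated by the proposed identity.\<close>
  have variety: "variety_T_ideal J \<alpha> \<beta>" if "free_T_ideal J" "I \<subseteq> J" for J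
  proof (intro variety_T_ideal.intro variety_T_ideal_axioms.intro that(1) assms(1))
    show "basic_identity \<alpha> \<beta> ?x ?y \<in> J"
      using that(2) T_ideal_gen_incl[of "{basic_identity \<alpha> \<beta> ?x ?y}" free_alg] unfolding I_eq by blast
  qed
  have fC: "f \<in> carrier free_alg"
    using assms(3) by (simp add: homogeneous_def)
  define J where "J = T_ideal_gen free_alg (insert f I)"
  have J: "free_T_ideal J"
    unfolding J_def using fC IC by (intro free_T_ideal_gen) simp
  have fJ: "f \<in> J" and IJ: "I \<subseteq> J"
    using T_ideal_gen_incl[of "insert f I" free_alg] by (auto simp: J_def)

  interpret K: free_T_ideal ?K
    by (rule free_T_ideal_commutative_identities)
  interpret J: variety_T_ideal J \<alpha> \<beta>
    using J IJ by (rule variety)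
  interpret I: variety_T_ideal I \<alpha> \<beta>
    using I by (rule variety) simp
  have commutators: "commutator (gen i) (gen j) \<in> ?K" for i j
    by (intro commutator_mem_commutative_identities gen_carrier)
  \<comment> \<open>Both terms of the defining identity contain the factor \<open>[x,y]\<close>, so
    commutative algebras satisfy it.\<close>
  have "I \<subseteq> ?K"
    unfolding I_eq basic_identity_def
    by (intro T_ideal_gen_least K.T_ideal) (auto intro: K.add K.scale K.mult_left K.mult_right commutators gen_carrier simp del: free_alg_simps)
  then have JK: "J \<subseteq> ?K" if "f \<in> ?K"
    unfolding J_def using that by (intro T_ideal_gen_least K.T_ideal) simp

  have "higher_consequences_equiv V n f {ncmono [0..<n + 1]}" if f: "f = ?x ^ n"
  proof -
    \<comment> \<open>For \<open>n = 0\<close> the power would be 1, which has a constant term and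
      is not in the free algebra.\<close>
    have "n > 0"
      using fC by (cases n) (auto simp: f)
    let ?G = "{ncmono [0..<n + 1] :: 'k ncpoly}"
    have "?G \<subseteq> words_above n"
      using ncmono_words_above[of n "[0..<n + 1]"] by simp
    moreover have "?G \<subseteq> J"
      using J.nilpotent_mem[OF _ \<open>n > 0\<close>] fJ by (simp add: f)
    moreover have "J \<inter> words_above n \<subseteq> T_ideal_gen free_alg (I \<union> ?G)"
    proof -
      have "free_T_ideal (T_ideal_gen free_alg (I \<union> ?G))"
        using IC J.subset_carrier \<open>?G \<subseteq> J\<close> by (intro free_T_ideal_gen) blast
      then have "words_above n \<subseteq> T_ideal_gen free_alg (I \<union> ?G)"
        using T_ideal_gen_incl[of "I \<union> ?G" free_alg] by (intro words_above_subset_T_ideal) auto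
      then show ?thesis
        by blast
    qed
    ultimately show ?thesis
      unfolding J_def I_def by (intro higher_consequences_equivI[OF V fC])
  qed
  moreover have "higher_consequences_equiv V n f {commutator ?x ?y * ?z}" if f: "f = commutator ?x ?y"
  proof -
    have "Poly_Mapping.lookup f (Word [0, 1]) \<noteq> 0"
      by (simp add: f commutator_def lookup_minus lookup_ncmono gen_def flip: ncmono_append)
    then have n: "n = 2"
      using homogeneous_degree[OF assms(3)] by fastforce
    let ?G = "{commutator ?x ?y * ?z}"
    have "commutator ?x ?y * ?z = ncmono [0, 1, 2] - ncmono [1, 0, 2]"
      by (simp add: commutator_def ncmono_Cons ncmono_Nil algebra_simps)
    also have "\<dots> \<in> words_above n"
      by (intro free_T_ideal.diff[OF free_T_ideal_words_above] ncmono_words_above) (simp_all add: n)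
    finally have "?G \<subseteq> words_above n"
      by simp
    moreover have "?G \<subseteq> J"
      using J.mult_right[OF fJ gen_carrier[of 2]] by (simp add: f)
    moreover have "J \<inter> words_above n \<subseteq> T_ideal_gen free_alg (I \<union> ?G)"
    proof
      fix p assume p: "p \<in> J \<inter> words_above n"
      have "free_T_ideal (T_ideal_gen free_alg (I \<union> ?G))"
        using IC J.subset_carrier \<open>?G \<subseteq> J\<close> by (intro free_T_ideal_gen) blast
      then interpret G: variety_T_ideal "T_ideal_gen free_alg (I \<union> ?G)" \<alpha> \<beta>
        using T_ideal_gen_incl[of "I \<union> ?G" free_alg] by (intro variety) auto
      have "commutator ?x ?y * ?z \<in> T_ideal_gen free_alg (I \<union> ?G)"
        using T_ideal_gen_incl[of "I \<union> ?G" free_alg] by auto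
      \<comment> \<open>All of \<open>J\<close> vanishes on commutative algebras because
        \<open>f\<close> is a commutator, and modulo the new identity letters commute already in
        degree 3.\<close>
      then show "p \<in> T_ideal_gen free_alg (I \<union> ?G)"
      proof (rule G.commutative_identity_mem[where N = 2, OF G.swap_letters_mem'])
        show "p \<in> ?K" "p \<in> words_above 2"
          using p JK commutators[of 0 1] by (auto simp: f n)
      qed
    qed
    ultimately show ?thesis
      unfolding J_def I_def by (intro higher_consequences_equivI[OF V fC])
  qed
  moreover have "no_higher_consequences V n f" if f: "f = commutator ?x ?y * ?x \<or> f = standard_poly 3"
  proof -
    have "Poly_Mapping.lookup (commutator ?x ?y * ?x) (Word [0, 1, 0]) \<noteq> 0"
      "Poly_Mapping.lookup (standard_poly 3 :: 'k ncpoly) (Word [0, 1, 2]) \<noteq> 0"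
      by (simp_all add: standard_poly_3 commutator_def left_diff_distrib lookup_minus lookup_add
          lookup_ncmono gen_def flip: ncmono_append)
    with f have "Poly_Mapping.lookup f (Word [0, 1, 0]) \<noteq> 0 \<or> Poly_Mapping.lookup f (Word [0, 1, 2]) \<noteq> 0"
      by blast
    then have n: "n = 3"
      using homogeneous_degree[OF assms(3)] by fastforce
    have "f \<in> ?K"
      using f
      by (auto simp: standard_poly_3 intro!: K.add K.mult_right commutators gen_carrier simp del: free_alg_simps)
    \<comment> \<open>Here letters commute modulo \<open>I\<close> itself in every degree above 3,
      so each element of \<open>J\<close> of such degree is already an identity of the
      variety.\<close>
    then have "J \<inter> words_above n \<subseteq> I"
      using JK by (intro subsetI I.commutative_identity_mem[where N = 3, OF I.swap_letters_mem]) (auto simp: n)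
    then show ?thesis
      unfolding J_def I_def by (intro no_higher_consequencesI[OF V fC])
  qed
  ultimately show ?thesis
    by blast
qed

end
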